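(* Let $\widehat{\mathfrak g}_1=(\mathbb R^8,\widehat\mu_1)$ and $\widehat{\mathfrak g}_2=(\mathbb R^8,\widehat\mu_2)$ be the real solvable Lie algebras defined on a basis $\{X_1,\dots,X_8\}$ by the following brackets (all brackets of basis vectors that are neither listed nor obtained from listed ones by antisymmetry are zero). For $\widehat\mu_1$: $\widehat\mu_1(X_1,X_i)=X_{i+1}$ for $2\le i\le 4$; $\widehat\mu_1(X_3,X_2)=X_6$; $\widehat\mu_1(X_6,X_2)=X_5$; $\widehat\mu_1(X_7,X_i)=X_i$ for $i=1,2$; $\widehat\mu_1(X_7,X_3)=2X_3$; $\widehat\mu_1(X_7,X_i)=3X_i$ for $i=4,6$; $\widehat\mu_1(X_7,X_5)=4X_5$; $\widehat\mu_1(X_8,X_1)=X_2$; $\widehat\mu_1(X_8,X_2)=-X_1$; $\widehat\mu_1(X_8,X_4)=-X_6$; $\widehat\mu_1(X_8,X_6)=X_4$. For $\widehat\mu_2$: $\widehat\mu_2(X_1,X_i)=X_{i+1}$ for $i=2,3,5$; $\widehat\mu_2(X_3,X_2)=-X_5$; $\widehat\mu_2(X_2,X_4)=X_6$; $\widehat\mu_2(X_7,X_i)=iX_i$ for $1\le i\le 6$; $\widehat\mu_2(X_8,X_i)=X_i$ for $i=2,3,4$; $\widehat\mu_2(X_8,X_i)=2X_i$ for $i=5,6$. Then $\widehat{\mathfrak g}_1$ and $\widehat{\mathfrak g}_2$ are rigid and complete over $\mathbb R$. Moreover, $\widehat{\mathfrak g}_1$ is not completely solvable.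
   Context: Let $L_n$ denote the set of Lie algebra laws on $\mathbb K^n$, defined by the Jacobi relations inside the space of alternating bilinear maps $\mathbb K^n\times\mathbb K^n\to\mathbb K^n$, on which $GL(n,\mathbb K)$ acts by change of basis. A Lie algebra with law in $L_n$ is rigid over $\mathbb K$ if its $GL(n,\mathbb K)$-orbit is open in $L_n$; for $\mathbb K=\mathbb R$ openness is with respect to the Euclidean topology. A Lie algebra is complete if its center is zero and all its derivations are inner. A Lie algebra $\mathfrak r$ over a field $\mathbb K$ is completely solvable if for every $X\in\mathfrak r$ all the eigenvalues of $\mathrm{ad}\,X$ (in an algebraic closure of $\mathbb K$) are elements of $\mathbb K$. *)

theory Defs
  imports "HOL-Analysis.Analysis"
begin

text \<open>A bilinear map on \<open>\<real>\<^sup>n\<close> (\<open>n = CARD('n)\<close>) is a plain function \<open>\<mu> x y\<close>; the laws form the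
  set \<open>lie_laws\<close>.\<close>

definition alternating_maps :: "(real^'n \<Rightarrow> real^'n \<Rightarrow> real^'n) set" where
  "alternating_maps = {\<mu>. bilinear \<mu> \<and> (\<forall>x. \<mu> x x = 0)}"

definition lie_laws :: "(real^'n \<Rightarrow> real^'n \<Rightarrow> real^'n) set" where
  "lie_laws = {\<mu> \<in> alternating_maps.
     \<forall>x y z. \<mu> x (\<mu> y z) + \<mu> y (\<mu> z x) + \<mu> z (\<mu> x y) = 0}"

definition structure_constants ::
    "(real^'n \<Rightarrow> real^'n \<Rightarrow> real^'n) \<Rightarrow> real^'n^'n^'n" where
  "structure_constants \<mu> = (\<chi> i j k. \<mu> (axis i 1) (axis j 1) $ k)"

text \<open>The Euclidean topology of the finite-dimensional space of alternating bilinear maps: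
  \<open>structure_constants\<close> is linear and injective there, so it is the topology induced by these
  coordinates.  (It is not the instance topology of the type of all functions.)\<close>

definition alternating_topology :: "(real^'n \<Rightarrow> real^'n \<Rightarrow> real^'n) topology" where
  "alternating_topology = pullback_topology alternating_maps structure_constants euclidean"

definition change_basis ::
    "real^'n^'n \<Rightarrow> (real^'n \<Rightarrow> real^'n \<Rightarrow> real^'n) \<Rightarrow> (real^'n \<Rightarrow> real^'n \<Rightarrow> real^'n)" where
  "change_basis g \<mu> = (\<lambda>x y. g *v \<mu> (matrix_inv g *v x) (matrix_inv g *v y))"

definition GL_orbit ::
    "(real^'n \<Rightarrow> real^'n \<Rightarrow> real^'n) \<Rightarrow> (real^'n \<Rightarrow> real^'n \<Rightarrow> real^'n) set" where
  "GL_orbit \<mu> = {change_basis g \<mu> | g. invertible g}"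

definition rigid :: "(real^'n \<Rightarrow> real^'n \<Rightarrow> real^'n) \<Rightarrow> bool" where
  "rigid \<mu> \<longleftrightarrow> \<mu> \<in> lie_laws \<and>
     openin (subtopology alternating_topology lie_laws) (GL_orbit \<mu>)"

definition center :: "(real^'n \<Rightarrow> real^'n \<Rightarrow> real^'n) \<Rightarrow> (real^'n) set" where
  "center \<mu> = {z. \<forall>x. \<mu> z x = 0}"

definition derivation ::
    "(real^'n \<Rightarrow> real^'n \<Rightarrow> real^'n) \<Rightarrow> (real^'n \<Rightarrow> real^'n) \<Rightarrow> bool" where
  "derivation \<mu> D \<longleftrightarrow> linear D \<and> (\<forall>x y. D (\<mu> x y) = \<mu> (D x) y + \<mu> x (D y))"

definition complete_algebra :: "(real^'n \<Rightarrow> real^'n \<Rightarrow> real^'n) \<Rightarrow> bool" where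
  "complete_algebra \<mu> \<longleftrightarrow> center \<mu> = {0} \<and> (\<forall>D. derivation \<mu> D \<longrightarrow> (\<exists>z. D = \<mu> z))"

fun derived_series :: "(real^'n \<Rightarrow> real^'n \<Rightarrow> real^'n) \<Rightarrow> nat \<Rightarrow> (real^'n) set" where
  "derived_series \<mu> 0 = UNIV"
| "derived_series \<mu> (Suc k) = span {\<mu> x y | x y. x \<in> derived_series \<mu> k \<and> y \<in> derived_series \<mu> k}"

definition solvable_algebra :: "(real^'n \<Rightarrow> real^'n \<Rightarrow> real^'n) \<Rightarrow> bool" where
  "solvable_algebra \<mu> \<longleftrightarrow> (\<exists>k. derived_series \<mu> k = {0})"

text \<open>Eigenvalues in the algebraic closure \<open>\<complex>\<close> of \<open>\<real>\<close>.\<close>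

definition complex_eigenvalue :: "(real^'n \<Rightarrow> real^'n) \<Rightarrow> complex \<Rightarrow> bool" where
  "complex_eigenvalue f c \<longleftrightarrow>
     (\<exists>v :: complex^'n. v \<noteq> 0 \<and> map_matrix complex_of_real (matrix f) *v v = c *s v)"

definition completely_solvable :: "(real^'n \<Rightarrow> real^'n \<Rightarrow> real^'n) \<Rightarrow> bool" where
  "completely_solvable \<mu> \<longleftrightarrow> (\<forall>x c. complex_eigenvalue (\<mu> x) c \<longrightarrow> c \<in> \<real>)"

text \<open>The alternating bilinear map given by a table of brackets: an entry \<open>(i, j, v)\<close> says
  \<open>\<mu> X\<^sub>i X\<^sub>j = v\<close> (hence \<open>\<mu> X\<^sub>j X\<^sub>i = - v\<close>).  Each unordered pair occurs at most once in a table, and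
  pairs that do not occur have bracket zero.\<close>

definition bracket_of :: "('n \<times> 'n \<times> (real^'n)) list \<Rightarrow> real^'n \<Rightarrow> real^'n \<Rightarrow> real^'n" where
  "bracket_of tab x y = (\<Sum>(i, j, v)\<leftarrow>tab. (x $ i * y $ j - x $ j * y $ i) *\<^sub>R v)"

text \<open>The index type \<open>8\<close> has the eight distinct elements \<open>1, \<dots>, 8\<close>, with \<open>8 = 0\<close>.\<close>

definition X :: "8 \<Rightarrow> real^8" where
  "X i = axis i 1"

definition \<mu>1 :: "real^8 \<Rightarrow> real^8 \<Rightarrow> real^8" where
  "\<mu>1 = bracket_of
    [(1, 2, X 3), (1, 3, X 4), (1, 4, X 5),
     (3, 2, X 6), (6, 2, X 5),
     (7, 1, X 1), (7, 2, X 2), (7, 3, 2 *\<^sub>R X 3),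
     (7, 4, 3 *\<^sub>R X 4), (7, 6, 3 *\<^sub>R X 6), (7, 5, 4 *\<^sub>R X 5),
     (8, 1, X 2), (8, 2, - X 1), (8, 4, - X 6), (8, 6, X 4)]"

definition \<mu>2 :: "real^8 \<Rightarrow> real^8 \<Rightarrow> real^8" where
  "\<mu>2 = bracket_of
    [(1, 2, X 3), (1, 3, X 4), (1, 5, X 6),
     (3, 2, - X 5), (2, 4, X 6),
     (7, 1, X 1), (7, 2, 2 *\<^sub>R X 2), (7, 3, 3 *\<^sub>R X 3),
     (7, 4, 4 *\<^sub>R X 4), (7, 5, 5 *\<^sub>R X 5), (7, 6, 6 *\<^sub>R X 6),
     (8, 2, X 2), (8, 3, X 3), (8, 4, X 4),
     (8, 5, 2 *\<^sub>R X 5), (8, 6, 2 *\<^sub>R X 6)]"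

end

theory Submission
  imports Defs
begin

text \<open>Rigidity follows the theorem of Nijenhuis and Richardson: if every 2-cocycle of a Lie
  algebra with values in itself is a coboundary, then its orbit is open. For a law \<open>\<mu>\<close> split the
  space of bilinear maps as \<open>Z \<oplus> W\<close> with \<open>Z\<close> the space of cocycles, which by hypothesis is also
  the tangent space of the orbit. An inverse-function argument writes every law near \<open>\<mu>\<close> as a
  change of basis of some \<open>\<mu> + w\<close> with \<open>w \<in> W\<close> small. The Jacobi identity of \<open>\<mu> + w\<close> says that the
  linear map \<open>d2\<close> (the derivative of the Jacobi expression at \<open>\<mu>\<close>, whose alternating zeros form
  \<open>Z\<close>) sends \<open>w\<close> to a quadratic expression in \<open>w\<close>. Being injective on the alternating elements of
  \<open>W\<close>, \<open>d2\<close> is bounded below there, and a small \<open>w\<close> must vanish (\<open>neighbourhood_in_orbit\<close>,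
  \<open>rigid_if_cocycles_are_coboundaries\<close>).

  It remains to compute cocycles and derivations of two algebras of dimension eight. Both contain
  an element \<open>x\<close> with \<open>ad x\<close> diagonal in the given basis: \<open>X\<^sub>7\<close> for the first and \<open>X\<^sub>7 + X\<^sub>8\<close> for
  the second. The Cartan homotopy formula shows that \<open>ad x\<close> acts trivially on cohomology, so that
  a cocycle only matters through its entries of weight zero, and likewise for a derivation
  (\<open>cocycle_modulo_coboundary\<close>, \<open>derivation_modulo_inner\<close>). This reduces the 224 unknown
  coefficients of a 2-cochain to 31 and 19, and the remaining linear systems are solved explicitly
  (\<open>\<mu>1_weight_zero_cocycle\<close>, \<open>\<mu>2_weight_zero_cocycle\<close>).

  The first algebra is not completely solvable because \<open>ad X\<^sub>8\<close> rotates the plane of \<open>X\<^sub>1\<close> and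
  \<open>X\<^sub>2\<close>: it has the eigenvalue \<open>\<i>\<close>.\<close>

section \<open>Bilinear maps and structure constants\<close>

definition bracket_from :: "real^'n^'n^'n \<Rightarrow> real^'n \<Rightarrow> real^'n \<Rightarrow> real^'n" where
  "bracket_from c x y = (\<Sum>i\<in>UNIV. \<Sum>j\<in>UNIV. (x $ i * y $ j) *\<^sub>R c $ i $ j)"

lemma bracket_from_add:
  "bracket_from (c + d) x y = bracket_from c x y + bracket_from d x y"
  "bracket_from c (x + x') y = bracket_from c x y + bracket_from c x' y"
  "bracket_from c x (y + y') = bracket_from c x y + bracket_from c x y'"
  by (simp_all add: bracket_from_def algebra_simps sum.distrib)

lemma bracket_from_scale:
  "bracket_from (r *\<^sub>R c) x y = r *\<^sub>R bracket_from c x y"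
  "bracket_from c (r *\<^sub>R x) y = r *\<^sub>R bracket_from c x y"
  "bracket_from c x (r *\<^sub>R y) = r *\<^sub>R bracket_from c x y"
  by (simp_all add: bracket_from_def scaleR_sum_right ac_simps)

lemmas bracket_from_linear = bracket_from_add bracket_from_scale

lemma bracket_from_diff:
  "bracket_from (c - d) x y = bracket_from c x y - bracket_from d x y"
  by (simp add: bracket_from_def algebra_simps sum_subtractf)

lemma bilinear_bracket_from: "bilinear (bracket_from c)"
  by (simp add: bilinear_def linear_iff bracket_from_linear)

lemma structure_constants_nth:
  "structure_constants \<mu> $ i $ j = \<mu> (axis i 1) (axis j 1)"
  by (simp add: structure_constants_def vec_eq_iff)

lemma structure_constants_eqI:
  "(\<And>i j. c $ i $ j = \<mu> (axis i 1) (axis j 1)) \<Longrightarrow> structure_constants \<mu> = c"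
  by (simp add: structure_constants_nth vec_eq_iff)

lemma bracket_from_axis: "bracket_from c (axis i 1) (axis j 1) = c $ i $ j"
proof -
  have "bracket_from c (axis i 1) (axis j 1) =
      (\<Sum>a\<in>UNIV. if a = i then (\<Sum>b\<in>UNIV. if b = j then c $ a $ b else 0) else 0)"
    unfolding bracket_from_def by (intro sum.cong refl) (simp add: axis_def if_distrib[of "\<lambda>t. t
      *\<^sub>R _"] cong: if_cong)
  then show ?thesis by simp
qed

lemma structure_constants_bracket_from [simp]: "structure_constants (bracket_from c) = c"
  by (rule structure_constants_eqI) (simp add: bracket_from_axis)

lemma basis_axis: "b \<in> (Basis :: (real^'n) set) \<Longrightarrow> \<exists>i. b = axis i 1"
  by (auto simp: Basis_vec_def)

lemma bilinear_eq_axis: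
  assumes "bilinear f" "bilinear g"
    and "\<And>i j. f (axis i 1) (axis j 1) = g (axis i 1) (axis j 1)"
  shows "f = (g :: real^'n \<Rightarrow> real^'n \<Rightarrow> 'a::real_vector)"
  by (rule bilinear_eq_stdbasis[OF assms(1,2)]) (metis basis_axis assms(3))

lemma bracket_from_structure_constants:
  "bilinear \<mu> \<Longrightarrow> bracket_from (structure_constants \<mu>) = \<mu>"
  by (rule bilinear_eq_axis) (auto simp: bilinear_bracket_from bracket_from_axis
    structure_constants_nth)

lemma lie_lawsD:
  assumes "\<mu> \<in> lie_laws"
  shows "bilinear \<mu>" "\<mu> x x = 0" "\<mu> x (\<mu> y z) + \<mu> y (\<mu> z x) + \<mu> z (\<mu> x y) = 0"
  using assms by (auto simp: lie_laws_def alternating_maps_def)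

lemma alternating_mapsD:
  assumes "\<mu> \<in> alternating_maps"
  shows "bilinear \<mu>" "\<mu> x x = 0"
  using assms by (auto simp: alternating_maps_def)

section \<open>Change of basis\<close>

lemma matrix_inv_properties:
  assumes "invertible (g :: real^'n^'n)"
  shows matrix_inv_left: "matrix_inv g ** g = mat 1"
    and matrix_inv_right: "g ** matrix_inv g = mat 1"
    and invertible_matrix_inv: "invertible (matrix_inv g)"
    and matrix_inv_matrix_inv: "matrix_inv (matrix_inv g) = g"
proof -
  show l: "matrix_inv g ** g = mat 1" and r: "g ** matrix_inv g = mat 1"
    using someI_ex[OF assms[unfolded invertible_def]] by (simp_all add: matrix_inv_def)
  then show i: "invertible (matrix_inv g)" by (auto simp: invertible_def)
  have "matrix_inv g ** matrix_inv (matrix_inv g) = mat 1"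
    using someI_ex[OF i[unfolded invertible_def]] by (simp add: matrix_inv_def)
  then show "matrix_inv (matrix_inv g) = g"
    by (metis r matrix_mul_assoc matrix_mul_lid matrix_mul_rid)
qed

lemma change_basis_eqI:
  assumes h: "invertible h" and eq: "\<And>x y. h *v \<mu> x y = \<nu> (h *v x) (h *v y)"
  shows "\<nu> = change_basis h \<mu>"
  unfolding change_basis_def
  by (intro ext) (simp add: eq matrix_vector_mul_assoc h matrix_inv_right)

lemma change_basis_inverse:
  assumes "invertible g"
  shows "change_basis (matrix_inv g) (change_basis g \<mu>) = \<mu>"
    "change_basis g (change_basis (matrix_inv g) \<mu>) = \<mu>"
  using assms by (auto simp: change_basis_def fun_eq_iff matrix_vector_mul_assoc
    matrix_inv_properties)

lemma change_basis_bilinear: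
  assumes "bilinear \<mu>" shows "bilinear (change_basis g \<mu>)"
  using assms unfolding bilinear_def linear_iff change_basis_def
  by (simp add: matrix_vector_right_distrib matrix_vector_mult_scaleR)

lemma change_basis_alternating:
  "\<mu> \<in> alternating_maps \<Longrightarrow> change_basis g \<mu> \<in> alternating_maps"
  by (simp add: alternating_maps_def change_basis_bilinear) (simp add: change_basis_def)

lemma change_basis_lie_laws:
  assumes g: "invertible g" and \<mu>: "\<mu> \<in> lie_laws"
  shows "change_basis g \<mu> \<in> lie_laws"
proof -
  have "change_basis g \<mu> x (change_basis g \<mu> y z) + change_basis g \<mu> y (change_basis g \<mu> z x)
      + change_basis g \<mu> z (change_basis g \<mu> x y) = 0" for x y z
    by (simp add: change_basis_def matrix_vector_mul_assoc g matrix_inv_left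
        matrix_vector_right_distrib[symmetric] lie_lawsD(3)[OF \<mu>])
  then show ?thesis
    using \<mu> change_basis_alternating by (auto simp: lie_laws_def)
qed

section \<open>Cocycles and coboundaries\<close>

text \<open>Up to sign, \<open>coboundary \<mu> D\<close> is the tangent vector at \<open>\<mu>\<close> of the curve obtained by changing
  the basis by \<open>1 + t D\<close>; it is the Chevalley-Eilenberg differential of the 1-cochain \<open>D\<close>, and it
  vanishes exactly when \<open>D\<close> is a derivation.\<close>

definition coboundary :: "(real^'n \<Rightarrow> real^'n \<Rightarrow> real^'n) \<Rightarrow> (real^'n \<Rightarrow> real^'n) \<Rightarrow>
    (real^'n \<Rightarrow> real^'n \<Rightarrow> real^'n)" where
  "coboundary \<mu> D = (\<lambda>x y. \<mu> (D x) y + \<mu> x (D y) - D (\<mu> x y))"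

text \<open>The cocycle condition is the Jacobi identity of \<open>\<mu> + t \<omega>\<close> to first order in \<open>t\<close>.\<close>

definition cocycle :: "(real^'n \<Rightarrow> real^'n \<Rightarrow> real^'n) \<Rightarrow>
    (real^'n \<Rightarrow> real^'n \<Rightarrow> real^'n) \<Rightarrow> bool" where
  "cocycle \<mu> \<omega> \<longleftrightarrow> \<omega> \<in> alternating_maps \<and>
    (\<forall>x y z. (\<mu> x (\<omega> y z) + \<mu> y (\<omega> z x) + \<mu> z (\<omega> x y))
       + (\<omega> x (\<mu> y z) + \<omega> y (\<mu> z x) + \<omega> z (\<mu> x y)) = 0)"

lemma alternating_skew:
  assumes "\<omega> \<in> alternating_maps"
  shows "\<omega> y x = - \<omega> x y"
proof -
  note [simp] = alternating_mapsD[OF assms]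
  have "\<omega> (x + y) (x + y) = \<omega> x y + \<omega> y x"
    by (simp only: bilinear_ladd[OF alternating_mapsD(1)[OF assms]]
        bilinear_radd[OF alternating_mapsD(1)[OF assms]]) simp
  then show ?thesis by (simp add: eq_neg_iff_add_eq_0 add.commute)
qed

lemma coboundary_alternating:
  assumes "\<mu> \<in> alternating_maps" "linear D"
  shows "coboundary \<mu> D \<in> alternating_maps"
proof -
  note b = alternating_mapsD(1)[OF assms(1)]
  have "bilinear (coboundary \<mu> D)"
    unfolding bilinear_def coboundary_def
    by (intro conjI allI linearI)
      (simp_all add: bilinear_ladd[OF b] bilinear_radd[OF b] bilinear_lmul[OF b]
        bilinear_rmul[OF b] linear_add[OF assms(2)] linear_cmul[OF assms(2)] algebra_simps)
  moreover have "coboundary \<mu> D x x = 0" for x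
    using alternating_skew[OF assms(1), of "D x" x]
    by (simp add: coboundary_def alternating_mapsD[OF assms(1)] linear_0[OF assms(2)])
  ultimately show ?thesis by (simp add: alternating_maps_def)
qed

text \<open>The Jacobi expression is equivariant under change of basis; differentiating this
  equivariance along \<open>D\<close> expresses the cocycle condition of the coboundary by four instances of
  the Jacobi identity of \<open>\<mu>\<close>.\<close>

lemma cocycle_coboundary:
  assumes \<mu>: "\<mu> \<in> lie_laws" and D: "linear D"
  shows "cocycle \<mu> (coboundary \<mu> D)"
proof -
  have alt: "\<mu> \<in> alternating_maps" using \<mu> by (simp add: lie_laws_def)
  note b = lie_lawsD(1)[OF \<mu>]
  note expand = bilinear_ladd[OF b] bilinear_radd[OF b] bilinear_lsub[OF b] bilinear_rsub[OF b]
    linear_add[OF D] linear_diff[OF D]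
  let ?jac = "\<lambda>x y z. \<mu> x (\<mu> y z) + \<mu> y (\<mu> z x) + \<mu> z (\<mu> x y)"
  have "(\<mu> x (coboundary \<mu> D y z) + \<mu> y (coboundary \<mu> D z x) + \<mu> z (coboundary \<mu> D x y))
       + (coboundary \<mu> D x (\<mu> y z) + coboundary \<mu> D y (\<mu> z x) + coboundary \<mu> D z (\<mu> x y))
     = ?jac (D x) y z + ?jac x (D y) z + ?jac x y (D z) - D (?jac x y z)" for x y z
    by (simp add: coboundary_def expand algebra_simps)
  then have "(\<mu> x (coboundary \<mu> D y z) + \<mu> y (coboundary \<mu> D z x) + \<mu> z (coboundary \<mu> D x y))
       + (coboundary \<mu> D x (\<mu> y z) + coboundary \<mu> D y (\<mu> z x) + coboundary \<mu> D z (\<mu> x y)) = 0" for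
         x y z
    by (simp add: lie_lawsD(3)[OF \<mu>] linear_0[OF D])
  then show ?thesis
    using coboundary_alternating[OF alt D] by (simp add: cocycle_def)
qed

lemma cocycle_diff:
  assumes \<mu>: "\<mu> \<in> lie_laws" and "cocycle \<mu> \<omega>" "cocycle \<mu> \<psi>"
  shows "cocycle \<mu> (\<lambda>x y. \<omega> x y - \<psi> x y)"
proof -
  note b = lie_lawsD(1)[OF \<mu>]
  have "bilinear (\<lambda>x y. \<omega> x y - \<psi> x y)"
    using assms(2,3) unfolding cocycle_def alternating_maps_def bilinear_def
    by (auto intro!: linear_compose_sub)
  moreover have "(\<mu> x (\<omega> y z - \<psi> y z) + \<mu> y (\<omega> z x - \<psi> z x) + \<mu> z (\<omega> x y - \<psi> x y))
      + ((\<omega> x (\<mu> y z) - \<psi> x (\<mu> y z)) + (\<omega> y (\<mu> z x) - \<psi> y (\<mu> z x))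
      + (\<omega> z (\<mu> x y) - \<psi> z (\<mu> x y))) = 0" (is "?lhs = 0") for x y z
  proof -
    have "?lhs = (\<mu> x (\<omega> y z) + \<mu> y (\<omega> z x) + \<mu> z (\<omega> x y))
        + (\<omega> x (\<mu> y z) + \<omega> y (\<mu> z x) + \<omega> z (\<mu> x y))
      - ((\<mu> x (\<psi> y z) + \<mu> y (\<psi> z x) + \<mu> z (\<psi> x y))
        + (\<psi> x (\<mu> y z) + \<psi> y (\<mu> z x) + \<psi> z (\<mu> x y)))"
      by (simp add: bilinear_rsub[OF b])
    also have "\<dots> = 0"
      using assms(2,3) by (simp add: cocycle_def)
    finally show ?thesis .
  qed
  ultimately show ?thesis
    using assms(2,3) by (simp add: cocycle_def alternating_maps_def)
qed

section \<open>Vanishing of the second cohomology implies rigidity\<close>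

text \<open>The polarised Jacobi expression in structure constants: \<open>jac c c = 0\<close> is the Jacobi identity
  of \<open>c\<close>, and \<open>jac m c + jac c m = 0\<close> is the condition that \<open>c\<close> be a cocycle for \<open>m\<close>. Recording it
  on basis vectors only makes it a bilinear map between Euclidean spaces, hence bounded.\<close>

definition jac :: "real^'n^'n^'n \<Rightarrow> real^'n^'n^'n \<Rightarrow> real^'n^'n^'n^'n" where
  "jac c d = (\<chi> i j k.
      bracket_from c (axis i 1) (bracket_from d (axis j 1) (axis k 1))
    + bracket_from c (axis j 1) (bracket_from d (axis k 1) (axis i 1))
    + bracket_from c (axis k 1) (bracket_from d (axis i 1) (axis j 1)))"

lemma bilinear_jac: "bilinear jac"
  by (simp add: bilinear_def linear_iff jac_def vec_eq_iff bracket_from_linear algebra_simps)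

lemma trilinear_eq_zero:
  fixes f :: "real^'n \<Rightarrow> real^'n \<Rightarrow> real^'n \<Rightarrow> 'a::real_vector"
  assumes "\<And>y z. linear (\<lambda>x. f x y z)" "\<And>x. bilinear (f x)"
    and "\<And>i j k. f (axis i 1) (axis j 1) (axis k 1) = 0"
  shows "f x y z = 0"
proof -
  have "(\<lambda>x. f x (axis j 1) (axis k 1)) = (\<lambda>x. 0)" for j k
    by (rule linear_eq_stdbasis) (auto simp: assms(1) linear_iff dest!: basis_axis simp: assms(3))
  then have "f x (axis j 1) (axis k 1) = 0" for x j k by metis
  then have "f x = (\<lambda>y z. 0)" for x
    by (intro bilinear_eq_axis) (auto simp: assms(2), auto simp: bilinear_def linear_iff)
  then show ?thesis by metis
qed

lemma jac_lie_law:
  assumes "\<And>x y z. bracket_from c x (bracket_from c y z) + bracket_from c y (bracket_from c z x)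
    + bracket_from c z (bracket_from c x y) = 0"
  shows "jac c c = 0"
  by (simp add: jac_def vec_eq_iff assms flip: vector_add_component)

lemma cocycle_bracket_from:
  assumes alt: "bracket_from c \<in> alternating_maps" and 0: "jac m c + jac c m = 0"
  shows "cocycle (bracket_from m) (bracket_from c)"
proof -
  let ?m = "bracket_from m" and ?c = "bracket_from c"
  let ?f = "\<lambda>x y z. (?m x (?c y z) + ?m y (?c z x) + ?m z (?c x y))
       + (?c x (?m y z) + ?c y (?m z x) + ?c z (?m x y))"
  have "?f (axis i 1) (axis j 1) (axis k 1) = 0" for i j k
    using 0 by (simp add: jac_def vec_eq_iff)
  note on_basis = this
  have "?f x y z = 0" for x y z
  proof (rule trilinear_eq_zero[where f = ?f])
    show "linear (\<lambda>x. ?f x y z)" for y z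
      by (intro linear_compose_add linearI) (simp_all add: bracket_from_linear)
    show "bilinear (?f x)" for x
      unfolding bilinear_def
      by (intro conjI allI linear_compose_add linearI) (simp_all add: bracket_from_linear)
  qed (rule on_basis)
  then show ?thesis using alt by (simp add: cocycle_def)
qed

text \<open>A change of basis by \<open>h\<close> acts on the value and on both arguments of a bracket. Splitting it
  into these three parts allows the equation \<open>h \<mu>(x, y) = \<nu>(h x, h y)\<close> to be written by bilinear
  maps, so that differentiating it never involves the inverse of \<open>h\<close>.\<close>

definition act_value :: "real^'n^'n \<Rightarrow> real^'n^'n^'n \<Rightarrow> real^'n^'n^'n" where
  "act_value A c = structure_constants (\<lambda>x y. A *v bracket_from c x y)"
definition act_left :: "real^'n^'n \<Rightarrow> real^'n^'n^'n \<Rightarrow> real^'n^'n^'n" where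
  "act_left A c = structure_constants (\<lambda>x y. bracket_from c (A *v x) y)"
definition act_right :: "real^'n^'n \<Rightarrow> real^'n^'n^'n \<Rightarrow> real^'n^'n^'n" where
  "act_right A c = structure_constants (\<lambda>x y. bracket_from c x (A *v y))"

lemma structure_constants_linear:
  "structure_constants (\<lambda>x y. f x y + g x y) = structure_constants f + structure_constants g"
  "structure_constants (\<lambda>x y. r *\<^sub>R f x y) = r *\<^sub>R structure_constants f"
  by (simp_all add: structure_constants_def vec_eq_iff)

lemma matrix_vector_mult_scaleR_left: "(r *\<^sub>R A) *v x = r *\<^sub>R (A *v (x::real^'n))"
  by (simp add: scaleR_matrix_vector_assoc)

lemmas act_simps = bracket_from_linear matrix_vector_mult_add_rdistrib
  matrix_vector_mult_scaleR_left matrix_vector_right_distrib matrix_vector_mult_scaleR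

lemma bilinear_act: "bilinear act_value" "bilinear act_left" "bilinear act_right"
  by (simp_all add: bilinear_def linear_iff act_value_def act_left_def act_right_def
      structure_constants_def vec_eq_iff act_simps)

lemma bracket_from_act:
  "bracket_from (act_value A c) x y = A *v bracket_from c x y"
  "bracket_from (act_left A c) x y = bracket_from c (A *v x) y"
  "bracket_from (act_right A c) x y = bracket_from c x (A *v y)"
proof -
  have "bilinear (\<lambda>x y. A *v bracket_from c x y)" "bilinear (\<lambda>x y. bracket_from c (A *v x) y)"
    "bilinear (\<lambda>x y. bracket_from c x (A *v y))"
    by (auto simp: bilinear_def linear_iff act_simps)
  then show "bracket_from (act_value A c) x y = A *v bracket_from c x y"
    "bracket_from (act_left A c) x y = bracket_from c (A *v x) y"
    "bracket_from (act_right A c) x y = bracket_from c x (A *v y)"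
    by (simp_all add: act_value_def act_left_def act_right_def bracket_from_structure_constants)
qed

lemma act_identity: "act_value (mat 1) c = c" "act_left (mat 1) c = c" "act_right (mat 1) c = c"
  by (simp_all add: act_value_def act_left_def act_right_def)

lemma continuous_on_det:
  fixes A :: "'a::topological_space \<Rightarrow> real^'n^'n"
  shows "continuous_on T A \<Longrightarrow> continuous_on T (\<lambda>x. det (A x))"
  unfolding det_def by (intro continuous_intros)

text \<open>The analytic core. The unknown \<open>v\<close> encodes a matrix \<open>A v\<close> near the identity and a small
  element \<open>w v\<close> of the complement \<open>W\<close> of the cocycles; the map \<open>H\<close> sends \<open>(c, v)\<close> to \<open>c\<close> together
  with the defect of the equation \<open>A v (\<mu> + w v) = c (A v, A v)\<close>. Its derivative at \<open>(m, 0)\<close> is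
  invertible, so \<open>H\<close> covers a neighbourhood of \<open>(m, 0)\<close>. In particular, for every \<open>c\<close> near \<open>m\<close> the
  equation has a solution \<open>v\<close> in the prescribed small set.\<close>

lemma neighbourhood_in_orbit:
  fixes \<mu> :: "real^'n \<Rightarrow> real^'n \<Rightarrow> real^'n"
  assumes \<mu>: "\<mu> \<in> lie_laws"
    and exact: "\<And>\<omega>. cocycle \<mu> \<omega> \<Longrightarrow> \<exists>D. linear D \<and> \<omega> = coboundary \<mu> D"
  obtains N where "open N" "structure_constants \<mu> \<in> N"
    "\<And>c. c \<in> N \<Longrightarrow> bracket_from c \<in> lie_laws \<Longrightarrow> bracket_from c \<in> GL_orbit \<mu>"
proof -
  define m where "m = structure_constants \<mu>"
  have m: "bracket_from m = \<mu>"
    by (simp add: m_def bracket_from_structure_constants lie_lawsD[OF \<mu>])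
  interpret J: bounded_bilinear "jac :: real^'n^'n^'n \<Rightarrow> _"
    using bilinear_jac by (simp add: bilinear_conv_bounded_bilinear)
  interpret V: bounded_bilinear "act_value :: real^'n^'n \<Rightarrow> _"
    using bilinear_act by (simp add: bilinear_conv_bounded_bilinear)
  interpret L: bounded_bilinear "act_left :: real^'n^'n \<Rightarrow> _"
    using bilinear_act by (simp add: bilinear_conv_bounded_bilinear)
  interpret R: bounded_bilinear "act_right :: real^'n^'n \<Rightarrow> _"
    using bilinear_act by (simp add: bilinear_conv_bounded_bilinear)

  \<comment> \<open>The differentials on 1-cochains and 2-cochains.\<close>
  define d1 where "d1 A = act_left A m + act_right A m - act_value A m" for A
  define d2 where "d2 c = jac m c + jac c m" for c
  define Alt where "Alt = {c. \<forall>x. bracket_from c x x = (0::real^'n)}"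
  define Z where "Z = {c \<in> Alt. d2 c = 0}"
  have lin_d1: "linear d1"
    by (simp add: linear_iff d1_def V.add_left L.add_left R.add_left V.scaleR_left L.scaleR_left
        R.scaleR_left algebra_simps)
  have lin_d2: "linear d2"
    by (simp add: linear_iff d2_def algebra_simps J.add_left J.add_right J.scaleR_left
      J.scaleR_right)
  have sub_Alt: "subspace Alt"
    by (auto simp: subspace_def Alt_def bracket_from_linear, simp add: bracket_from_def)
  have sub_Z: "subspace Z"
    using sub_Alt lin_d2 by (auto simp: subspace_def Z_def linear_iff linear_0)
  have Z_d1: "Z \<subseteq> range d1"
  proof
    fix c assume "c \<in> Z"
    then have "cocycle \<mu> (bracket_from c)"
      using cocycle_bracket_from[of c m] bilinear_bracket_from[of c]
      by (auto simp: Z_def Alt_def d2_def m alternating_maps_def)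
    then obtain D where D: "linear D" "bracket_from c = coboundary \<mu> D"
      using exact by blast
    have "bracket_from (d1 (matrix D)) = bracket_from c"
      by (intro ext) (simp add: d1_def D(2) coboundary_def bracket_from_act m matrix_works D(1)
          bracket_from_add bracket_from_diff)
    then have "d1 (matrix D) = c" by (metis structure_constants_bracket_from)
    then show "c \<in> range d1" by blast
  qed
  obtain h where h: "linear h" "\<And>c. c \<in> Z \<Longrightarrow> d1 (h c) = c"
    using linear_exists_right_inverse_on[OF lin_d1 subspace_UNIV] Z_d1 by blast

  obtain p where p: "linear p" "\<And>c. p c \<in> Z" "\<And>z. z \<in> Z \<Longrightarrow> p z = z"
    using linear_exists_left_inverse_on[OF linear_id sub_Z] by (auto simp: id_def)
  define W where "W = {w. p w = 0}"
  have sub_W: "subspace W"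
    unfolding W_def by (rule linear_subspace_kernel[OF p(1)])
  have inj: "w = 0" if "w \<in> Alt \<inter> W" "d2 w = 0" for w
    using that p(3)[of w] by (simp add: W_def Z_def)
  have "\<exists>e>0. \<forall>w\<in>Alt \<inter> W. norm (d2 w) \<ge> e * norm w"
    using inj by (intro injective_imp_isometric closed_subspace subspace_inter sub_Alt sub_W)
      (auto simp: linear_conv_bounded_linear[symmetric] lin_d2)
  then obtain e where e: "e > 0" "\<And>w. w \<in> Alt \<Longrightarrow> w \<in> W \<Longrightarrow> e * norm w \<le> norm (d2 w)"
    by blast
  obtain K where K: "K > 0" "\<And>c d. norm (jac c d :: real^'n^'n^'n^'n) \<le> norm c * norm d * K"
    using J.pos_bounded by blast
  \<comment> \<open>The Jacobi identity of \<open>m + w\<close> equates the linear term \<open>d2 w\<close>, of norm at least \<open>e * norm w\<close>,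
    with a quadratic term, of norm at most \<open>K * norm w * norm w\<close>.\<close>
  have small: "w = 0" if w: "w \<in> W" "norm w < e / K" and lie: "bracket_from (m + w) \<in> lie_laws"
    for w
  proof (rule ccontr)
    assume "w \<noteq> 0"
    have alt: "w \<in> Alt"
      using lie_lawsD(2)[OF lie] lie_lawsD(2)[OF \<mu>] by (auto simp: Alt_def bracket_from_add m)
    have "jac (m + w) (m + w) = 0" "jac m m = 0"
      using lie_lawsD(3)[OF lie] lie_lawsD(3)[OF \<mu>] by (auto intro!: jac_lie_law simp: m)
    then have "d2 w = - jac w w"
      by (simp add: d2_def J.add_left J.add_right eq_neg_iff_add_eq_0 algebra_simps)
    then have "e * norm w \<le> (K * norm w) * norm w"
      using e(2)[OF alt w(1)] K(2)[of w w] by (simp add: mult_ac)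
    then have "e \<le> K * norm w"
      using \<open>w \<noteq> 0\<close> by simp
    then show False using w(2) K(1) by (simp add: field_simps)
  qed

  \<comment> \<open>The sign in \<open>A\<close> makes the two parts of the derivative of the defect add up: the cocycle part
    \<open>p v\<close> comes from \<open>A\<close> through \<open>d1\<close>, the rest of \<open>v\<close> comes from \<open>w\<close>.\<close>
  define A where "A v = mat 1 - h (p v)" for v
  define w where "w v = v - p v" for v
  define H where "H = (\<lambda>(c, v). (c, act_right (A v) (act_left (A v) c) - act_value (A v) (m + w
    v)))"
  define S where "S = {(c :: real^'n^'n^'n, v). det (A v) \<noteq> 0 \<and> norm (w v) < e / K}"
  have hp: "linear (\<lambda>v. h (p v))"
    using linear_compose[OF p(1) h(1)] by (simp add: o_def)
  have [simp]: "h 0 = 0" "p 0 = 0" "A 0 = mat 1" "w 0 = 0"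
    by (simp_all add: A_def w_def h p linear_0)
  have contA: "continuous_on T (\<lambda>x :: (real^'n^'n^'n) \<times> (real^'n^'n^'n). A (snd x))" for T
    unfolding A_def by (intro continuous_intros linear_continuous_on_compose[OF _ hp])
  have contw: "continuous_on T (\<lambda>x :: (real^'n^'n^'n) \<times> (real^'n^'n^'n). w (snd x))" for T
    unfolding w_def by (intro continuous_intros linear_continuous_on_compose[OF _ p(1)])
  have "open S"
    unfolding S_def case_prod_beta
    by (intro open_Collect_conj open_Collect_neq open_Collect_less continuous_on_const
        continuous_on_norm continuous_on_det contA contw)
  moreover have "continuous_on S H"
    unfolding H_def case_prod_beta
    by (intro continuous_on_Pair continuous_on_diff continuous_on_add continuous_on_fst
        continuous_on_id continuous_on_const V.continuous_on L.continuous_on R.continuous_on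
        contA contw)
  moreover have "(m, 0) \<in> S"
    using e K by (simp add: S_def)
  moreover have "(H has_derivative (\<lambda>(c, v). (c, c - v))) (at (m, 0))"
  proof -
    have snd: "(snd has_derivative snd) F" for F :: "((real^'n^'n^'n) \<times> (real^'n^'n^'n)) filter"
      by (rule has_derivative_snd[OF has_derivative_ident])
    have hpd: "((\<lambda>x. h (p (snd x))) has_derivative (\<lambda>x. h (p (snd x)))) F"
      for F :: "((real^'n^'n^'n) \<times> (real^'n^'n^'n)) filter"
      using bounded_linear.has_derivative[OF _ snd] hp linear_conv_bounded_linear by blast
    have pd: "((\<lambda>x. p (snd x)) has_derivative (\<lambda>x. p (snd x))) F"
      for F :: "((real^'n^'n^'n) \<times> (real^'n^'n^'n)) filter"
      using bounded_linear.has_derivative[OF _ snd] p(1) linear_conv_bounded_linear by blast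
    have dA: "((\<lambda>x. A (snd x)) has_derivative (\<lambda>x. - h (p (snd x)))) F"
      for F :: "((real^'n^'n^'n) \<times> (real^'n^'n^'n)) filter"
      unfolding A_def using has_derivative_diff[OF has_derivative_const hpd] by simp
    have dw: "((\<lambda>x. w (snd x)) has_derivative (\<lambda>x. snd x - p (snd x))) F"
      for F :: "((real^'n^'n^'n) \<times> (real^'n^'n^'n)) filter"
      unfolding w_def by (rule has_derivative_diff[OF snd pd])
    have d: "d1 (h (p v)) = p v" for v
      using h(2) p(2) by blast
    show ?thesis
      unfolding H_def case_prod_beta
      apply (rule has_derivative_eq_rhs)
       apply (rule has_derivative_Pair has_derivative_diff
          has_derivative_add has_derivative_const has_derivative_fst has_derivative_ident
          dA dw V.FDERIV L.FDERIV R.FDERIV)+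
      apply (use d in \<open>simp add: fun_eq_iff act_identity d1_def V.minus_left L.minus_left
            R.minus_left algebra_simps\<close>)
      done
  qed
  \<comment> \<open>The derivative is an involution, so it serves as its own right inverse.\<close>
  moreover have "(\<lambda>(c, v). (c, c - v)) \<circ> (\<lambda>(c, v). (c, c - v :: real^'n^'n^'n)) = id"
    by auto
  moreover have "bounded_linear (\<lambda>(c, v). (c, c - v :: real^'n^'n^'n))"
    unfolding linear_conv_bounded_linear[symmetric] by (auto simp: linear_iff algebra_simps)
  ultimately have "H (m, 0) \<in> interior (H ` S)"
    using sussmann_open_mapping[of S H "(m, 0)" _ _ S] by (simp add: interior_open)
  moreover have "H (m, 0) = (m, 0)"
    by (simp add: H_def act_identity)
  ultimately have "(m, 0) \<in> interior (H ` S)" by simp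
  define N where "N = (\<lambda>c. (c, 0)) -` interior (H ` S)"
  have "open N"
    unfolding N_def by (intro open_vimage continuous_intros) auto
  moreover have "m \<in> N"
    using \<open>(m, 0) \<in> interior (H ` S)\<close> by (simp add: N_def)
  moreover have "bracket_from c \<in> GL_orbit \<mu>" if c: "c \<in> N" and lie: "bracket_from c \<in> lie_laws"
    for c
  proof -
    have "(c, 0) \<in> H ` S"
      using c interior_subset by (auto simp: N_def)
    then obtain v where v: "(c, v) \<in> S"
      "act_right (A v) (act_left (A v) c) = act_value (A v) (m + w v)"
      by (auto simp: H_def)
    have inv: "invertible (A v)"
      using v(1) by (simp add: S_def invertible_det_nz)
    have "A v *v bracket_from (m + w v) x y = bracket_from c (A v *v x) (A v *v y)" for x y
      using arg_cong[OF v(2), of "\<lambda>c. bracket_from c x y"] by (simp add: bracket_from_act)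
    then have eq: "bracket_from c = change_basis (A v) (bracket_from (m + w v))"
      by (rule change_basis_eqI[OF inv])
    then have "bracket_from (m + w v) = change_basis (matrix_inv (A v)) (bracket_from c)"
      using change_basis_inverse(1)[OF inv] by metis
    also have "\<dots> \<in> lie_laws"
      using change_basis_lie_laws lie inv by (metis invertible_matrix_inv)
    finally have "w v = 0"
      using small[of "w v"] v(1) p by (simp add: S_def w_def W_def linear_diff)
    then show ?thesis
      using eq inv by (auto simp: m GL_orbit_def)
  qed
  ultimately show ?thesis
    using that[of N] by (simp add: m_def)
qed

text \<open>A neighbourhood of \<open>\<mu>\<close> inside its orbit suffices, because the group acts by homeomorphisms:
  the orbit is the trace on the laws of the union of the translates of that neighbourhood.\<close>

theorem rigid_if_cocycles_are_coboundaries: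
  fixes \<mu> :: "real^'n \<Rightarrow> real^'n \<Rightarrow> real^'n"
  assumes \<mu>: "\<mu> \<in> lie_laws"
    and exact: "\<And>\<omega>. cocycle \<mu> \<omega> \<Longrightarrow> \<exists>D. linear D \<and> \<omega> = coboundary \<mu> D"
  shows "rigid \<mu>"
proof -
  obtain N where N: "open N" "structure_constants \<mu> \<in> N"
    "\<And>c. c \<in> N \<Longrightarrow> bracket_from c \<in> lie_laws \<Longrightarrow> bracket_from c \<in> GL_orbit \<mu>"
    using neighbourhood_in_orbit[OF assms] by blast
  define pull where "pull g c = structure_constants (change_basis (matrix_inv g) (bracket_from c))"
    for g :: "real^'n^'n" and c
  define U where "U = (\<Union>g\<in>{g. invertible g}. pull g -` N)"
  have "linear (pull g)" for g
    by (simp add: pull_def linear_iff change_basis_def structure_constants_linear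
      matrix_vector_right_distrib
        matrix_vector_mult_scaleR bracket_from_linear)
  then have "open (pull g -` N)" for g
    by (intro open_vimage N(1) linear_continuous_on) (simp add: linear_conv_bounded_linear)
  then have "open U" by (auto simp: U_def)
  have pull: "pull g (structure_constants \<nu>) = structure_constants (change_basis (matrix_inv g) \<nu>)"
    if "\<nu> \<in> lie_laws" for g \<nu>
    using that by (simp add: pull_def bracket_from_structure_constants lie_lawsD(1))
  have cancel: "matrix_inv g *v (g *v x) = x" if "invertible g" for g :: "real^'n^'n" and x
    by (simp add: matrix_vector_mul_assoc matrix_inv_left that)
  have "GL_orbit \<mu> = (structure_constants -` U \<inter> alternating_maps) \<inter> lie_laws" (is "_ = ?R")
  proof
    show "GL_orbit \<mu> \<subseteq> ?R"
    proof
      fix \<nu> assume "\<nu> \<in> GL_orbit \<mu>"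
      then obtain g where g: "invertible g" "\<nu> = change_basis g \<mu>" by (auto simp: GL_orbit_def)
      then have lie: "\<nu> \<in> lie_laws" using \<mu> change_basis_lie_laws by blast
      then have "structure_constants \<nu> \<in> U"
        using g N(2) by (auto simp: U_def pull change_basis_inverse intro!: exI[of _ g])
      then show "\<nu> \<in> ?R" using lie by (auto simp: lie_laws_def)
    qed
    show "?R \<subseteq> GL_orbit \<mu>"
    proof
      fix \<nu> assume "\<nu> \<in> ?R"
      then obtain g where g: "invertible g" "pull g (structure_constants \<nu>) \<in> N"
        and lie: "\<nu> \<in> lie_laws" by (auto simp: U_def)
      let ?\<nu>' = "change_basis (matrix_inv g) \<nu>"
      have lie': "?\<nu>' \<in> lie_laws"
        using lie g(1) change_basis_lie_laws by (metis invertible_matrix_inv)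
      then have "?\<nu>' \<in> GL_orbit \<mu>"
        using N(3)[of "structure_constants ?\<nu>'"] g(2) pull[OF lie]
        by (simp add: bracket_from_structure_constants lie_lawsD(1))
      then obtain k where k: "invertible k" "?\<nu>' = change_basis k \<mu>" by (auto simp: GL_orbit_def)
      have "\<nu> = change_basis g (change_basis k \<mu>)"
        using change_basis_inverse(2)[OF g(1)] k(2) by metis
      also have "\<dots> = change_basis (g ** k) \<mu>"
      proof (rule change_basis_eqI)
        show "invertible (g ** k)" using g(1) k(1) invertible_mult by blast
        show "(g ** k) *v \<mu> x y = change_basis g (change_basis k \<mu>) ((g ** k) *v x) ((g ** k) *v
          y)" for x y
          by (simp add: change_basis_def matrix_vector_mul_assoc[symmetric]
              cancel[OF g(1)] cancel[OF k(1)])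
      qed
      finally show "\<nu> \<in> GL_orbit \<mu>"
        using g(1) k(1) invertible_mult by (auto simp: GL_orbit_def)
    qed
  qed
  then show ?thesis
    using \<mu> \<open>open U\<close> unfolding rigid_def openin_subtopology alternating_topology_def
      openin_pullback_topology by auto
qed

lemma axis_nth_if: "axis i (1::real) $ k = (if k = i then 1 else 0)"
  by (simp add: axis_def)

section \<open>Reduction to weight zero\<close>

text \<open>A single diagonal element already grades the cochains by real weights. No other semisimple
  element has to be diagonalisable over the reals, and in the first algebra \<open>ad X\<^sub>8\<close> is not.\<close>

locale diagonal_element =
  fixes \<mu> :: "real^'n \<Rightarrow> real^'n \<Rightarrow> real^'n" and x :: "real^'n" and w :: "'n \<Rightarrow> real"
  assumes lie: "\<mu> \<in> lie_laws"
    and diagonal: "\<And>j. \<mu> x (axis j 1) = w j *\<^sub>R axis j 1"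
begin

lemma alt: "\<mu> \<in> alternating_maps"
  using lie by (simp add: lie_laws_def)

lemmas bilin = bilinear_ladd[OF lie_lawsD(1)[OF lie]] bilinear_radd[OF lie_lawsD(1)[OF lie]]
  bilinear_lmul[OF lie_lawsD(1)[OF lie]] bilinear_rmul[OF lie_lawsD(1)[OF lie]]
  bilinear_lsub[OF lie_lawsD(1)[OF lie]] bilinear_rsub[OF lie_lawsD(1)[OF lie]]
  bilinear_lneg[OF lie_lawsD(1)[OF lie]] bilinear_rneg[OF lie_lawsD(1)[OF lie]]

lemma diagonal_nth: "\<mu> x v $ k = w k * v $ k"
proof -
  have "linear (\<mu> x)" using lie_lawsD(1)[OF lie] by (simp add: bilinear_def)
  moreover have "linear (\<lambda>v. \<chi> k. w k * v $ k)"
    by (auto simp: linear_iff vec_eq_iff algebra_simps)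
  ultimately have "\<mu> x = (\<lambda>v. \<chi> k. w k * v $ k)"
    by (rule linear_eq_stdbasis) (auto dest!: basis_axis simp: diagonal vec_eq_iff axis_nth_if)
  then show ?thesis by simp
qed

lemma weight_vector_nth:
  assumes "\<mu> x v = s *\<^sub>R v" "w k \<noteq> s"
  shows "v $ k = 0"
  using arg_cong[OF assms(1), of "\<lambda>v. v $ k"] assms(2) by (simp add: diagonal_nth)

lemma weight_bracket:
  assumes "\<mu> x a = s *\<^sub>R a" "\<mu> x b = r *\<^sub>R b"
  shows "\<mu> x (\<mu> a b) = (s + r) *\<^sub>R \<mu> a b"
proof -
  have "\<mu> x (\<mu> a b) = - \<mu> a (\<mu> b x) - \<mu> b (\<mu> x a)"
    using lie_lawsD(3)[OF lie, of x a b] by (simp add: algebra_simps eq_neg_iff_add_eq_0)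
  also have "\<dots> = r *\<^sub>R \<mu> a b - s *\<^sub>R \<mu> b a"
    using alternating_skew[OF alt, of b x] by (simp add: assms bilin)
  finally show ?thesis
    using alternating_skew[OF alt, of a b] by (simp add: algebra_simps)
qed

text \<open>Writing a derivation \<open>D\<close> in weight components, the part of \<open>D x\<close> of nonzero weight is in the
  image of \<open>ad x\<close>, so it can be removed by an inner derivation. If \<open>D x\<close> has weight zero, then
  \<open>[D, ad x] = ad (D x)\<close> preserves weights. But \<open>[D, ad x]\<close> multiplies the \<open>(j, k)\<close> entry of \<open>D\<close>
  by \<open>w j - w k\<close>, so the entries between different weights vanish.\<close>

lemma derivation_modulo_inner:
  assumes D: "derivation \<mu> D"
  obtains z where "derivation \<mu> (\<lambda>y. D y - \<mu> z y)"
    "\<And>j k. w k \<noteq> w j \<Longrightarrow> (D (axis j 1) - \<mu> z (axis j 1)) $ k = 0"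
proof -
  define z :: "real^'n" where "z = (\<chi> k. if w k = 0 then 0 else - D x $ k / w k)"
  define E where "E y = D y - \<mu> z y" for y
  have D_mult: "D (\<mu> a b) = \<mu> (D a) b + \<mu> a (D b)" for a b
    using D by (simp add: derivation_def)
  have z_mult: "\<mu> z (\<mu> a b) = \<mu> (\<mu> z a) b + \<mu> a (\<mu> z b)" for a b
  proof -
    have "\<mu> a (\<mu> b z) = - \<mu> a (\<mu> z b)" "\<mu> b (\<mu> z a) = - \<mu> (\<mu> z a) b"
      using alternating_skew[OF alt, of b z] alternating_skew[OF alt, of b "\<mu> z a"]
      by (simp_all add: bilin)
    then show ?thesis using lie_lawsD(3)[OF lie, of z a b] by (simp add: algebra_simps)
  qed
  have E_mult: "E (\<mu> a b) = \<mu> (E a) b + \<mu> a (E b)" for a b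
    by (simp add: E_def D_mult z_mult bilin)
  have "\<mu> x (E x) = 0 *\<^sub>R E x"
    by (simp add: vec_eq_iff diagonal_nth E_def alternating_skew[OF alt, of z x]) (simp add: z_def)
  then have Ex: "\<mu> x (\<mu> (E x) (axis j 1)) = w j *\<^sub>R \<mu> (E x) (axis j 1)" for j
    using weight_bracket[OF _ diagonal, of "E x" 0 j] by simp
  have "E (axis j 1) $ k = 0" if "w k \<noteq> w j" for j k
  proof -
    have lin: "E (w j *\<^sub>R axis j 1) = w j *\<^sub>R E (axis j 1)"
      using D by (simp add: derivation_def E_def linear_cmul bilin algebra_simps)
    have "w j * E (axis j 1) $ k = \<mu> (E x) (axis j 1) $ k + w k * E (axis j 1) $ k"
      using arg_cong[OF E_mult[of x "axis j 1"], of "\<lambda>v. v $ k"]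
      by (simp add: diagonal lin diagonal_nth)
    moreover have "\<mu> (E x) (axis j 1) $ k = 0"
      using weight_vector_nth[OF Ex that] .
    ultimately show ?thesis using that by (simp add: field_simps)
  qed
  moreover have "linear E"
    using D lie_lawsD(1)[OF lie] unfolding E_def[abs_def]
    by (intro linear_compose_sub) (simp_all add: derivation_def bilinear_def)
  ultimately show ?thesis using that[of z] E_mult unfolding derivation_def E_def[abs_def] by simp
qed

text \<open>Cartan's formula \<open>L\<^sub>x \<omega> = d (\<omega> x)\<close> for a cocycle \<open>\<omega>\<close>, where \<open>L\<^sub>x\<close> multiplies the entry \<open>(i,
  j, k)\<close> of \<open>\<omega>\<close> by \<open>w k - w i - w j\<close>. First a coboundary is subtracted so that the 1-cochain \<open>\<omega> x\<close>
  commutes with \<open>ad x\<close>: this fixes the entries of \<open>D\<close> between different weights. Then \<open>d (\<omega> x)\<close>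
  has weight zero as well, and the formula forces the entries of \<open>\<omega>\<close> of nonzero weight to vanish.\<close>

lemma cocycle_modulo_coboundary:
  assumes \<omega>: "cocycle \<mu> \<omega>"
  obtains D where "linear D" "cocycle \<mu> (\<lambda>a b. \<omega> a b - coboundary \<mu> D a b)"
    "\<And>i j k. w k \<noteq> w i + w j \<Longrightarrow>
      (\<omega> (axis i 1) (axis j 1) - coboundary \<mu> D (axis i 1) (axis j 1)) $ k = 0"
proof -
  have \<omega>_alt: "\<omega> \<in> alternating_maps" using \<omega> by (simp add: cocycle_def)
  have lin_x: "linear (\<omega> x)"
    using alternating_mapsD(1)[OF \<omega>_alt] by (simp add: bilinear_def)
  define M :: "real^'n^'n" where
    "M = (\<chi> k j. if w k = w j then 0 else \<omega> x (axis j 1) $ k / (w k - w j))"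
  define D where "D v = M *v v" for v
  have D: "linear D" by (simp add: D_def[abs_def])
  define \<psi> where "\<psi> a b = \<omega> a b - coboundary \<mu> D a b" for a b
  have \<psi>: "cocycle \<mu> \<psi>"
    unfolding \<psi>_def[abs_def] by (rule cocycle_diff[OF lie \<omega> cocycle_coboundary[OF lie D]])
  have \<psi>_alt: "\<psi> \<in> alternating_maps" using \<psi> by (simp add: cocycle_def)
  note \<psi>_bil = alternating_mapsD(1)[OF \<psi>_alt]
  have D_axis: "D (axis j 1) $ k = M $ k $ j" for j k
    by (simp add: D_def matrix_vector_mult_basis column_def)
  \<comment> \<open>As \<open>\<mu> x x = 0\<close>, the vector \<open>x\<close> lies in the weight-zero space.  There \<open>D\<close> acts as \<open>\<omega> x\<close>
    divided by the weight of the target, so \<open>\<omega> x x = 0\<close> gives \<open>D x = 0\<close>.\<close>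
  have wx: "w j * x $ j = 0" for j
    using diagonal_nth[of x j] lie_lawsD(2)[OF lie, of x] by simp
  have Dx: "D x = 0"
  proof (rule vec_eq_iff[THEN iffD2], intro allI, simp)
    fix k
    have x_sum: "x = (\<Sum>j\<in>UNIV. x $ j *\<^sub>R axis j 1)"
      by (simp add: basis_expansion[unfolded scalar_mult_eq_scaleR] flip: scalar_mult_eq_scaleR)
    have "(\<Sum>j\<in>UNIV. x $ j * \<omega> x (axis j 1) $ k) = \<omega> x (\<Sum>j\<in>UNIV. x $ j *\<^sub>R axis j 1) $ k"
      by (simp add: linear_sum[OF lin_x] linear_cmul[OF lin_x])
    then have *: "(\<Sum>j\<in>UNIV. x $ j * \<omega> x (axis j 1) $ k) = 0"
      using x_sum alternating_mapsD(2)[OF \<omega>_alt] by simp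
    have "D x $ k = (\<Sum>j\<in>UNIV. M $ k $ j * x $ j)"
      by (simp add: D_def matrix_vector_mult_def)
    also have "\<dots> = (\<Sum>j\<in>UNIV. (if w k = 0 then 0 else 1 / w k) * (x $ j * \<omega> x (axis j 1) $ k))"
    proof (rule sum.cong[OF refl])
      fix j
      show "M $ k $ j * x $ j = (if w k = 0 then 0 else 1 / w k) * (x $ j * \<omega> x (axis j 1) $ k)"
        using wx[of j] by (cases "x $ j = 0") (auto simp: M_def)
    qed
    also have "\<dots> = 0"
      using * by (simp flip: sum_distrib_left)
    finally show "D x $ k = 0" .
  qed
  have \<psi>x: "\<psi> x (axis j 1) $ k = 0" if "w k \<noteq> w j" for j k
  proof -
    have "coboundary \<mu> D x (axis j 1) $ k = (w k - w j) * M $ k $ j"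
      by (simp add: coboundary_def Dx diagonal linear_cmul[OF D] D_axis diagonal_nth
          bilinear_lzero[OF lie_lawsD(1)[OF lie]] algebra_simps)
    then show ?thesis using that by (simp add: \<psi>_def M_def)
  qed
  then have \<psi>x_weight: "\<mu> x (\<psi> x (axis j 1)) = w j *\<^sub>R \<psi> x (axis j 1)" for j
    by (auto simp: vec_eq_iff diagonal_nth)
  have "linear (\<lambda>v. \<mu> x (\<psi> x v))" "linear (\<lambda>v. \<psi> x (\<mu> x v))"
    using linear_compose[of "\<psi> x" "\<mu> x"] linear_compose[of "\<mu> x" "\<psi> x"]
      lie_lawsD(1)[OF lie] \<psi>_bil by (simp_all add: bilinear_def o_def)
  then have "(\<lambda>v. \<mu> x (\<psi> x v)) = (\<lambda>v. \<psi> x (\<mu> x v))"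
    by (rule linear_eq_stdbasis)
      (auto dest!: basis_axis simp: diagonal \<psi>x_weight bilinear_rmul[OF \<psi>_bil])
  then have commute: "\<mu> x (\<psi> x v) = \<psi> x (\<mu> x v)" for v by metis
  have "\<psi> (axis i 1) (axis j 1) $ k = 0" if k: "w k \<noteq> w i + w j" for i j k
  proof -
    let ?a = "axis i 1 :: real^'n" and ?b = "axis j 1 :: real^'n"
    \<comment> \<open>The value at \<open>(a, b)\<close> of the differential of \<open>\<psi> x\<close>, up to sign.\<close>
    define t where "t = \<psi> x (\<mu> ?a ?b) - \<mu> (\<psi> x ?a) ?b - \<mu> ?a (\<psi> x ?b)"
    have "\<mu> x t = (w i + w j) *\<^sub>R t"
      by (simp add: t_def bilin commute weight_bracket[OF diagonal diagonal]
          weight_bracket[OF \<psi>x_weight diagonal] weight_bracket[OF diagonal \<psi>x_weight]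
          bilinear_rmul[OF \<psi>_bil] scaleR_right_diff_distrib)
    then have "t $ k = 0" using weight_vector_nth k by blast
    moreover have "\<mu> x (\<psi> ?a ?b) + t = (w i + w j) *\<^sub>R \<psi> ?a ?b"
    proof -
      have "\<psi> ?a (\<mu> ?b x) = - (w j *\<^sub>R \<psi> ?a ?b)" "\<psi> ?b (\<mu> x ?a) = - (w i *\<^sub>R \<psi> ?a ?b)"
        "\<mu> ?a (\<psi> ?b x) = - \<mu> ?a (\<psi> x ?b)" "\<mu> ?b (\<psi> x ?a) = - \<mu> (\<psi> x ?a) ?b"
        using alternating_skew[OF alt, of ?b x] alternating_skew[OF \<psi>_alt, of ?b ?a]
          alternating_skew[OF \<psi>_alt, of ?b x] alternating_skew[OF alt, of ?b "\<psi> x ?a"]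
        by (simp_all add: diagonal bilin bilinear_rmul[OF \<psi>_bil] bilinear_rneg[OF \<psi>_bil])
      moreover have "\<mu> x (\<psi> ?a ?b) + \<mu> ?a (\<psi> ?b x) + \<mu> ?b (\<psi> x ?a)
          + (\<psi> x (\<mu> ?a ?b) + \<psi> ?a (\<mu> ?b x) + \<psi> ?b (\<mu> x ?a)) = 0"
        using \<psi> by (simp add: cocycle_def)
      ultimately show ?thesis
        by (simp add: t_def algebra_simps)
    qed
    then have "(w k - (w i + w j)) * \<psi> ?a ?b $ k + t $ k = 0"
      by (auto simp: vec_eq_iff diagonal_nth algebra_simps)
    ultimately show ?thesis using k by simp
  qed
  then show ?thesis using that[OF D] \<psi> unfolding \<psi>_def[abs_def] by simp
qed

theorem rigid_by_weights:
  assumes "\<And>\<omega>. cocycle \<mu> \<omega> \<Longrightarrow>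
      (\<And>i j k. w k \<noteq> w i + w j \<Longrightarrow> \<omega> (axis i 1) (axis j 1) $ k = 0) \<Longrightarrow>
      \<exists>D. linear D \<and> \<omega> = coboundary \<mu> D"
  shows "rigid \<mu>"
proof (rule rigid_if_cocycles_are_coboundaries[OF lie])
  fix \<omega> assume "cocycle \<mu> \<omega>"
  then obtain D where D: "linear D" "cocycle \<mu> (\<lambda>a b. \<omega> a b - coboundary \<mu> D a b)"
    "\<And>i j k. w k \<noteq> w i + w j \<Longrightarrow>
      (\<omega> (axis i 1) (axis j 1) - coboundary \<mu> D (axis i 1) (axis j 1)) $ k = 0"
    using cocycle_modulo_coboundary by blast
  obtain E where E: "linear E" "(\<lambda>a b. \<omega> a b - coboundary \<mu> D a b) = coboundary \<mu> E"
    using assms[OF D(2,3)] by blast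
  have "\<omega> a b = coboundary \<mu> (\<lambda>v. D v + E v) a b" for a b
    using fun_cong[OF fun_cong[OF E(2)], of a b] by (simp add: coboundary_def bilin algebra_simps)
  then show "\<exists>D. linear D \<and> \<omega> = coboundary \<mu> D"
    using linear_compose_add[OF D(1) E(1)] by blast
qed

theorem complete_by_weights:
  assumes "\<And>D. derivation \<mu> D \<Longrightarrow> (\<And>j k. w k \<noteq> w j \<Longrightarrow> D (axis j 1) $ k = 0) \<Longrightarrow> \<exists>z. D = \<mu> z"
    and "center \<mu> = {0}"
  shows "complete_algebra \<mu>"
proof -
  have "\<exists>z. D = \<mu> z" if der: "derivation \<mu> D" for D
  proof -
    obtain z where z: "derivation \<mu> (\<lambda>y. D y - \<mu> z y)"
      "\<And>j k. w k \<noteq> w j \<Longrightarrow> (D (axis j 1) - \<mu> z (axis j 1)) $ k = 0"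
      using derivation_modulo_inner[OF der] by blast
    obtain z' where z': "(\<lambda>y. D y - \<mu> z y) = \<mu> z'"
      using assms(1)[OF z] by blast
    have "D y = \<mu> (z + z') y" for y
      using fun_cong[OF z', of y] by (simp add: bilin algebra_simps)
    then show ?thesis by blast
  qed
  then show ?thesis using assms(2) by (simp add: complete_algebra_def)
qed

end

section \<open>Coordinates in dimension eight\<close>

lemma UNIV_8: "(UNIV :: 8 set) = {1, 2, 3, 4, 5, 6, 7, 8}"
  by (rule card_subset_eq[symmetric]) simp_all

lemma forall_8: "(\<forall>i::8. P i) \<longleftrightarrow> P 1 \<and> P 2 \<and> P 3 \<and> P 4 \<and> P 5 \<and> P 6 \<and> P 7 \<and> P 8"
  using UNIV_8 by (metis UNIV_I empty_iff insert_iff)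

lemma sum_8: "(\<Sum>i\<in>(UNIV::8 set). f i) = f 1 + f 2 + f 3 + f 4 + f 5 + f 6 + f 7 + f 8"
  unfolding UNIV_8 by (simp add: add.assoc)

lemma X_nth: "X i $ j = (if j = i then 1 else 0)"
  by (simp add: X_def axis_def)

lemma bracket_of_alternating: "bracket_of tab \<in> alternating_maps"
proof -
  have "bracket_of tab x x = 0 \<and> bracket_of tab (x + x') y = bracket_of tab x y + bracket_of tab
    x' y
    \<and> bracket_of tab x (y + y') = bracket_of tab x y + bracket_of tab x y'
    \<and> bracket_of tab (r *\<^sub>R x) y = r *\<^sub>R bracket_of tab x y
    \<and> bracket_of tab x (r *\<^sub>R y) = r *\<^sub>R bracket_of tab x y" for x x' y y' r
    by (induction tab) (auto simp: bracket_of_def algebra_simps)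
  then show ?thesis by (simp add: alternating_maps_def bilinear_def linear_iff)
qed

abbreviation minor :: "real^'n \<Rightarrow> real^'n \<Rightarrow> 'n \<Rightarrow> 'n \<Rightarrow> real" where
  "minor x y i j \<equiv> x $ i * y $ j - x $ j * y $ i"

lemma \<mu>1_nth:
  "\<mu>1 x y $ 1 = minor x y 7 1 - minor x y 8 2"
  "\<mu>1 x y $ 2 = minor x y 7 2 + minor x y 8 1"
  "\<mu>1 x y $ 3 = minor x y 1 2 + 2 * minor x y 7 3"
  "\<mu>1 x y $ 4 = minor x y 1 3 + 3 * minor x y 7 4 + minor x y 8 6"
  "\<mu>1 x y $ 5 = minor x y 1 4 + minor x y 6 2 + 4 * minor x y 7 5"
  "\<mu>1 x y $ 6 = minor x y 3 2 + 3 * minor x y 7 6 - minor x y 8 4"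
  "\<mu>1 x y $ 7 = 0" "\<mu>1 x y $ 8 = 0"
  by (simp_all add: \<mu>1_def bracket_of_def X_nth)

lemma \<mu>2_nth:
  "\<mu>2 x y $ 1 = minor x y 7 1"
  "\<mu>2 x y $ 2 = 2 * minor x y 7 2 + minor x y 8 2"
  "\<mu>2 x y $ 3 = minor x y 1 2 + 3 * minor x y 7 3 + minor x y 8 3"
  "\<mu>2 x y $ 4 = minor x y 1 3 + 4 * minor x y 7 4 + minor x y 8 4"
  "\<mu>2 x y $ 5 = - minor x y 3 2 + 5 * minor x y 7 5 + 2 * minor x y 8 5"
  "\<mu>2 x y $ 6 = minor x y 1 5 + minor x y 2 4 + 6 * minor x y 7 6 + 2 * minor x y 8 6"
  "\<mu>2 x y $ 7 = 0" "\<mu>2 x y $ 8 = 0"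
  by (simp_all add: \<mu>2_def bracket_of_def X_nth algebra_simps)

lemma \<mu>1_lie_law: "\<mu>1 \<in> lie_laws"
proof -
  have "\<mu>1 x (\<mu>1 y z) + \<mu>1 y (\<mu>1 z x) + \<mu>1 z (\<mu>1 x y) = 0" for x y z
    by (simp add: vec_eq_iff forall_8 \<mu>1_nth algebra_simps)
  then show ?thesis
    using bracket_of_alternating by (simp add: lie_laws_def \<mu>1_def)
qed

lemma \<mu>2_lie_law: "\<mu>2 \<in> lie_laws"
proof -
  have "\<mu>2 x (\<mu>2 y z) + \<mu>2 y (\<mu>2 z x) + \<mu>2 z (\<mu>2 x y) = 0" for x y z
    by (simp add: vec_eq_iff forall_8 \<mu>2_nth algebra_simps)
  then show ?thesis
    using bracket_of_alternating by (simp add: lie_laws_def \<mu>2_def)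
qed

lemma linear_nth_expand:
  fixes f :: "real^'n \<Rightarrow> real^'n"
  assumes lin: "linear f"
  shows "f v $ k = (\<Sum>a\<in>UNIV. v $ a * f (axis a 1) $ k)"
proof -
  have "f v = f (\<Sum>a\<in>UNIV. v $ a *\<^sub>R axis a 1)"
    by (simp add: basis_expansion flip: scalar_mult_eq_scaleR)
  also have "\<dots> $ k = (\<Sum>a\<in>UNIV. v $ a * f (axis a 1) $ k)"
    by (simp add: linear_sum[OF lin] linear_cmul[OF lin])
  finally show ?thesis .
qed

lemma bilinear_nth_expand:
  fixes \<omega> :: "real^'n \<Rightarrow> real^'n \<Rightarrow> real^'n"
  assumes "bilinear \<omega>"
  shows "\<omega> u v $ k = (\<Sum>a\<in>UNIV. v $ a * \<omega> u (axis a 1) $ k)"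
  using assms linear_nth_expand[of "\<omega> u" v k] by (simp add: bilinear_def)

text \<open>Rewriting with antisymmetry itself would loop; these instances put the indices of a cochain
  in increasing order.\<close>

lemma skew_8:
  fixes c :: "8 \<Rightarrow> 8 \<Rightarrow> 8 \<Rightarrow> real"
  assumes "\<And>i j k. c j i k = - c i j k"
  shows
    "c 2 1 k = - c 1 2 k" "c 3 1 k = - c 1 3 k" "c 4 1 k = - c 1 4 k"
    "c 5 1 k = - c 1 5 k" "c 6 1 k = - c 1 6 k" "c 7 1 k = - c 1 7 k"
    "c 8 1 k = - c 1 8 k" "c 3 2 k = - c 2 3 k" "c 4 2 k = - c 2 4 k"
    "c 5 2 k = - c 2 5 k" "c 6 2 k = - c 2 6 k" "c 7 2 k = - c 2 7 k"
    "c 8 2 k = - c 2 8 k" "c 4 3 k = - c 3 4 k" "c 5 3 k = - c 3 5 k"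
    "c 6 3 k = - c 3 6 k" "c 7 3 k = - c 3 7 k" "c 8 3 k = - c 3 8 k"
    "c 5 4 k = - c 4 5 k" "c 6 4 k = - c 4 6 k" "c 7 4 k = - c 4 7 k"
    "c 8 4 k = - c 4 8 k" "c 6 5 k = - c 5 6 k" "c 7 5 k = - c 5 7 k"
    "c 8 5 k = - c 5 8 k" "c 7 6 k = - c 6 7 k" "c 8 6 k = - c 6 8 k"
    "c 8 7 k = - c 7 8 k"
  by (rule assms)+

text \<open>In this form, instances at numerals simplify to linear relations between the entries of
  \<open>D\<close>.\<close>

lemma derivation_nth:
  fixes \<mu> :: "real^8 \<Rightarrow> real^8 \<Rightarrow> real^8"
  assumes "derivation \<mu> D"
  shows "(\<Sum>a\<in>UNIV. \<mu> (X i) (X j) $ a * D (X a) $ k) = \<mu> (D (X i)) (X j) $ k + \<mu> (X i) (D (X j)) $ k"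
  using assms linear_nth_expand[of D "\<mu> (X i) (X j)" k]
  by (simp add: derivation_def X_def)

text \<open>Each instance is one linear equation on the entries of the cochain, whose coefficients are
  the structure constants of \<open>\<mu>\<close>.\<close>

lemma cocycle_nth:
  fixes \<mu> \<omega> :: "real^8 \<Rightarrow> real^8 \<Rightarrow> real^8"
  assumes "cocycle \<mu> \<omega>"
  shows "(\<mu> (X i) (\<omega> (X j) (X l)) + \<mu> (X j) (\<omega> (X l) (X i)) + \<mu> (X l) (\<omega> (X i) (X j))) $ k
    + (\<Sum>a\<in>UNIV. \<mu> (X j) (X l) $ a * \<omega> (X i) (X a) $ k + \<mu> (X l) (X i) $ a * \<omega> (X j) (X a) $ k
        + \<mu> (X i) (X j) $ a * \<omega> (X l) (X a) $ k) = 0"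
proof -
  have bil: "bilinear \<omega>" using assms alternating_mapsD(1) by (auto simp: cocycle_def)
  have "(\<mu> (X i) (\<omega> (X j) (X l)) + \<mu> (X j) (\<omega> (X l) (X i)) + \<mu> (X l) (\<omega> (X i) (X j))) $ k
    + (\<omega> (X i) (\<mu> (X j) (X l)) $ k + \<omega> (X j) (\<mu> (X l) (X i)) $ k + \<omega> (X l) (\<mu> (X i) (X j)) $ k) = 0"
    using assms unfolding cocycle_def by (simp flip: vector_add_component)
  then show ?thesis
    unfolding bilinear_nth_expand[OF bil, of _ "\<mu> _ _"] by (simp add: sum.distrib X_def)
qed

section \<open>Cocycles and derivations of the first algebra\<close>

definition weight1 :: "8 \<Rightarrow> real" where
  "weight1 i = (X 1 + X 2 + 2 *\<^sub>R X 3 + 3 *\<^sub>R X 4 + 4 *\<^sub>R X 5 + 3 *\<^sub>R X 6) $ i"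

lemma weight1_values:
  "weight1 1 = 1" "weight1 2 = 1" "weight1 3 = 2" "weight1 4 = 3"
  "weight1 5 = 4" "weight1 6 = 3" "weight1 7 = 0" "weight1 8 = 0"
  by (simp_all add: weight1_def X_nth)

interpretation mu1: diagonal_element \<mu>1 "X 7" weight1
proof
  have "\<forall>j. \<mu>1 (X 7) (X j) = weight1 j *\<^sub>R X j"
    by (simp add: forall_8 vec_eq_iff \<mu>1_nth X_nth weight1_values)
  then show "\<mu>1 (X 7) (axis j 1) = weight1 j *\<^sub>R axis j 1" for j
    by (simp add: X_def)
qed (rule \<mu>1_lie_law)

text \<open>There are 31 entries of weight zero. The coboundaries of weight zero form a space of
  dimension 12: the weight-zero matrices have dimension 14, and the derivations among them are
  spanned by \<open>ad X\<^sub>7\<close> and \<open>ad X\<^sub>8\<close>. The 19 independent relations used below therefore leave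
  nothing else. The linear map \<open>D\<close> solves 12 of the equations \<open>\<omega> = coboundary \<mu>1 D\<close>, normalised by
  \<open>D X\<^sub>1 = 0\<close>, which uses up the freedom of adding a derivation; the relations give the other 19
  equations.\<close>

lemma \<mu>1_weight_zero_cocycle:
  assumes \<omega>: "cocycle \<mu>1 \<omega>"
    and weight: "\<And>i j k. weight1 k \<noteq> weight1 i + weight1 j \<Longrightarrow> \<omega> (X i) (X j) $ k = 0"
  shows "\<exists>D. linear D \<and> \<omega> = coboundary \<mu>1 D"
proof -
  have alt: "\<omega> \<in> alternating_maps" using \<omega> by (simp add: cocycle_def)
  define c where "c i j k = \<omega> (X i) (X j) $ k" for i j k
  have c: "\<omega> (X i) (X j) $ k = c i j k" for i j k
    by (simp add: c_def)
  have zero: "weight1 k \<noteq> weight1 i + weight1 j \<Longrightarrow> c i j k = 0" for i j k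
    by (simp add: c_def weight)
  have skew: "c j i k = - c i j k" for i j k
    by (simp add: c_def alternating_skew[OF alt, of "X j"])
  have diag: "c i i k = 0" for i k
    by (simp add: c_def alternating_mapsD(2)[OF alt])
  note order = skew_8[of c, OF skew]
  note expand = sum_8 \<mu>1_nth X_nth c zero order diag weight1_values
  note J = cocycle_nth[OF \<omega>]
  have rel1: "- c 7 8 7 = 0"
    using J[of 3 7 8 3] by (simp add: expand)
  have rel2: "c 1 7 2 + c 4 7 6 = 0"
    using J[of 1 3 7 6] by (simp add: expand)
  have rel3: "c 1 7 2 - c 6 7 4 = 0"
    using J[of 1 6 7 5] by (simp add: expand)
  have rel4: "c 2 7 1 + c 6 7 4 = 0"
    using J[of 2 3 7 4] by (simp add: expand)
  have rel5: "c 1 7 1 + c 2 7 2 - c 3 7 3 = 0"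
    using J[of 1 2 7 3] by (simp add: expand)
  have rel6: "c 1 8 1 + c 2 8 2 - c 3 8 3 = 0"
    using J[of 1 2 8 3] by (simp add: expand)
  have rel7: "c 1 7 1 + c 3 7 3 - c 4 7 4 = 0"
    using J[of 1 3 7 4] by (simp add: expand)
  have rel8: "c 1 7 1 + c 4 7 4 - c 5 7 5 = 0"
    using J[of 1 4 7 5] by (simp add: expand)
  have rel9: "c 1 7 1 - c 2 7 2 - c 7 8 8 = 0"
    using J[of 1 7 8 2] by (simp add: expand)
  have rel10: "c 2 7 2 + c 3 7 3 - c 6 7 6 = 0"
    using J[of 2 3 7 6] by (simp add: expand)
  have rel11: "c 2 7 2 - c 5 7 5 + c 6 7 6 = 0"
    using J[of 2 6 7 5] by (simp add: expand)
  have rel12: "c 1 3 6 - c 1 6 5 + c 2 3 4 - c 2 4 5 = 0"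
    using J[of 1 2 3 5] by (simp add: expand)
  have rel13: "c 1 3 4 + c 1 8 2 + c 2 3 6 + c 4 8 6 = 0"
    using J[of 1 3 8 6] by (simp add: expand)
  have rel14: "c 1 4 5 + c 1 8 2 + c 2 6 5 - c 6 8 4 = 0"
    using J[of 1 6 8 5] by (simp add: expand)
  have rel15: "c 1 3 4 + c 2 3 6 + c 2 8 1 + c 6 8 4 = 0"
    using J[of 2 3 8 4] by (simp add: expand)
  have rel16: "c 1 3 6 + c 1 8 1 - c 2 3 4 + c 3 8 3 - c 4 8 4 = 0"
    using J[of 1 3 8 4] by (simp add: expand)
  have rel17: "c 1 6 5 + c 1 8 1 - c 2 4 5 + c 4 8 4 - c 5 8 5 = 0"
    using J[of 1 4 8 5] by (simp add: expand)
  have rel18: "c 1 3 6 - c 2 3 4 - c 2 8 2 - c 3 8 3 + c 6 8 6 = 0"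
    using J[of 2 3 8 6] by (simp add: expand)
  have rel19: "c 1 6 5 - c 2 4 5 - c 2 8 2 + c 5 8 5 - c 6 8 6 = 0"
    using J[of 2 6 8 5] by (simp add: expand)
  note relations = rel1 rel2 rel3 rel4 rel5 rel6 rel7 rel8 rel9 rel10 rel11 rel12 rel13 rel14
    rel15 rel16 rel17 rel18 rel19
  define d21 where "d21 = - c 1 6 5 + c 2 3 4"
  define d22 where "d22 = - c 1 3 4 / 2 - c 1 4 5 / 2 - c 2 3 6 / 2 - c 2 6 5 / 2"
  define d33 where "d33 = - c 1 2 3 - c 1 3 4 / 2 - c 1 4 5 / 2 - c 2 3 6 / 2 - c 2 6 5 / 2"
  define d44 where "d44 = - c 1 2 3 - 3 / 2 * c 1 3 4 - c 1 4 5 / 2 - c 2 3 6 / 2 - c 2 6 5 / 2"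
  define d46 where "d46 = - c 1 3 6"
  define d55 where "d55 = - c 1 2 3 - 3 / 2 * c 1 3 4 - 3 / 2 * c 1 4 5 - c 2 3 6 / 2 - c 2 6 5 / 2"
  define d64 where "d64 = c 1 6 5"
  define d66 where "d66 = - c 1 2 3 - c 1 3 4 - c 1 4 5 - c 2 6 5"
  define d77 where "d77 = - c 1 7 1"
  define d78 where "d78 = - c 1 7 2"
  define d87 where "d87 = - c 3 8 3 / 2"
  define d88 where "d88 = - c 1 3 4 / 2 - c 1 4 5 / 2 - c 1 8 2 - c 2 3 6 / 2 - c 2 6 5 / 2"
  define D :: "real^8 \<Rightarrow> real^8" where "D v =
      (v $ 2 * d21) *\<^sub>R X 1
      + (v $ 2 * d22) *\<^sub>R X 2
      + (v $ 3 * d33) *\<^sub>R X 3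
      + (v $ 4 * d44) *\<^sub>R X 4
      + (v $ 4 * d46) *\<^sub>R X 6
      + (v $ 5 * d55) *\<^sub>R X 5
      + (v $ 6 * d64) *\<^sub>R X 4
      + (v $ 6 * d66) *\<^sub>R X 6
      + (v $ 7 * d77) *\<^sub>R X 7
      + (v $ 7 * d78) *\<^sub>R X 8
      + (v $ 8 * d87) *\<^sub>R X 7
      + (v $ 8 * d88) *\<^sub>R X 8" for v
  have D: "linear D"
    by (simp add: linear_iff D_def algebra_simps)
  have D_nth:
    "D v $ 1 = d21 * v $ 2"
    "D v $ 2 = d22 * v $ 2"
    "D v $ 3 = d33 * v $ 3"
    "D v $ 4 = d44 * v $ 4 + d64 * v $ 6"
    "D v $ 5 = d55 * v $ 5"
    "D v $ 6 = d46 * v $ 4 + d66 * v $ 6"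
    "D v $ 7 = d77 * v $ 7 + d87 * v $ 8"
    "D v $ 8 = d78 * v $ 7 + d88 * v $ 8"
    for v by (simp_all add: D_def X_nth)
  have coboundary_nth: "coboundary \<mu>1 D a b $ k = \<mu>1 (D a) b $ k + \<mu>1 a (D b) $ k - D (\<mu>1 a b) $ k"
    for a b k by (simp add: coboundary_def)
  have "\<forall>i j k. \<omega> (X i) (X j) $ k = coboundary \<mu>1 D (X i) (X j) $ k"
    using relations by (simp add: forall_8 coboundary_nth D_nth expand d21_def d22_def d33_def
      d44_def d46_def d55_def d64_def d66_def d77_def d78_def d87_def d88_def)
  then have "\<omega> = coboundary \<mu>1 D"
    using alternating_mapsD(1)[OF alt] alternating_mapsD(1)[OF coboundary_alternating[OF mu1.alt D]]
    by (intro bilinear_eq_axis) (simp_all add: X_def vec_eq_iff)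
  then show ?thesis using D by blast
qed

text \<open>A derivation of weight zero is determined by its value \<open>d\<^sub>1\<^sub>1 X\<^sub>1 + d\<^sub>1\<^sub>2 X\<^sub>2\<close> at \<open>X\<^sub>1\<close>, and
  \<open>ad X\<^sub>7\<close>, \<open>ad X\<^sub>8\<close> send \<open>X\<^sub>1\<close> to \<open>X\<^sub>1\<close>, \<open>X\<^sub>2\<close>.\<close>

lemma \<mu>1_weight_zero_derivation:
  assumes D: "derivation \<mu>1 D"
    and weight: "\<And>j k. weight1 k \<noteq> weight1 j \<Longrightarrow> D (X j) $ k = 0"
  shows "\<exists>z. D = \<mu>1 z"
proof -
  define d where "d j k = D (X j) $ k" for j k
  have d: "D (X j) $ k = d j k" for j k
    by (simp add: d_def)
  have zero: "weight1 k \<noteq> weight1 j \<Longrightarrow> d j k = 0" for j k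
    by (simp add: d_def weight)
  note expand = sum_8 \<mu>1_nth X_nth d zero weight1_values
  note L = derivation_nth[OF D]
  have rel1: "- d 7 7 = 0"
    using L[of 1 7 1] by (simp add: expand)
  have rel2: "- d 7 8 = 0"
    using L[of 1 7 2] by (simp add: expand)
  have rel3: "- d 8 7 = 0"
    using L[of 3 8 3] by (simp add: expand)
  have rel4: "d 1 2 + d 4 6 = 0"
    using L[of 1 3 6] by (simp add: expand)
  have rel5: "d 1 2 - d 6 4 = 0"
    using L[of 1 6 5] by (simp add: expand)
  have rel6: "d 2 1 + d 6 4 = 0"
    using L[of 2 3 4] by (simp add: expand)
  have rel7: "d 1 1 + d 2 2 - d 3 3 = 0"
    using L[of 1 2 3] by (simp add: expand)
  have rel8: "d 1 1 + d 3 3 - d 4 4 = 0"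
    using L[of 1 3 4] by (simp add: expand)
  have rel9: "d 1 1 + d 4 4 - d 5 5 = 0"
    using L[of 1 4 5] by (simp add: expand)
  have rel10: "d 1 1 - d 2 2 + d 8 8 = 0"
    using L[of 1 8 2] by (simp add: expand)
  have rel11: "d 2 2 + d 3 3 - d 6 6 = 0"
    using L[of 2 3 6] by (simp add: expand)
  have rel12: "d 2 2 - d 5 5 + d 6 6 = 0"
    using L[of 2 6 5] by (simp add: expand)
  note relations = rel1 rel2 rel3 rel4 rel5 rel6 rel7 rel8 rel9 rel10 rel11 rel12
  define z where "z = D (X 1) $ 1 *\<^sub>R X 7 + D (X 1) $ 2 *\<^sub>R X 8"
  have "\<forall>j k. D (X j) $ k = \<mu>1 z (X j) $ k"
    using relations by (simp add: forall_8 z_def expand)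
  then have "D = \<mu>1 z"
    using D lie_lawsD(1)[OF \<mu>1_lie_law]
    by (intro linear_eq_stdbasis)
      (auto dest!: basis_axis simp: X_def vec_eq_iff derivation_def bilinear_def)
  then show ?thesis by blast
qed

lemma center_\<mu>1: "center \<mu>1 = {0}"
proof -
  have "z = 0" if z: "\<And>x. \<mu>1 z x = 0" for z
  proof -
    have "\<mu>1 z (X i) $ k = 0" for i k
      by (simp add: z)
    from this[of 7 1] this[of 7 2] this[of 7 3] this[of 7 4] this[of 7 5] this[of 7 6] this[of 1
      1] this[of 1 2]
    show ?thesis
      by (simp add: \<mu>1_nth X_nth vec_eq_iff forall_8)
  qed
  then show ?thesis
    using bilinear_lzero[OF lie_lawsD(1)[OF \<mu>1_lie_law]] by (auto simp: center_def)
qed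

section \<open>Cocycles and derivations of the second algebra\<close>

text \<open>The coincidences \<open>w k = w i + w j\<close> between the weights of \<open>X\<^sub>7 + X\<^sub>8\<close> are those that hold
  for both \<open>X\<^sub>7\<close> and \<open>X\<^sub>8\<close>, so that this single element carries the information of the whole
  torus.\<close>

definition weight2 :: "8 \<Rightarrow> real" where
  "weight2 i = (X 1 + 3 *\<^sub>R X 2 + 4 *\<^sub>R X 3 + 5 *\<^sub>R X 4 + 7 *\<^sub>R X 5 + 8 *\<^sub>R X 6) $ i"

lemma weight2_values:
  "weight2 1 = 1" "weight2 2 = 3" "weight2 3 = 4" "weight2 4 = 5"
  "weight2 5 = 7" "weight2 6 = 8" "weight2 7 = 0" "weight2 8 = 0"
  by (simp_all add: weight2_def X_nth)

interpretation mu2: diagonal_element \<mu>2 "X 7 + X 8" weight2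
proof
  have "\<forall>j. \<mu>2 (X 7 + X 8) (X j) = weight2 j *\<^sub>R X j"
    by (simp add: forall_8 vec_eq_iff \<mu>2_nth X_nth weight2_values)
  then show "\<mu>2 (X 7 + X 8) (axis j 1) = weight2 j *\<^sub>R axis j 1" for j
    by (simp add: X_def)
qed (rule \<mu>2_lie_law)

text \<open>Now 19 entries have weight zero, the weight-zero matrices have dimension 10 and contain the
  two-dimensional space of derivations spanned by \<open>ad X\<^sub>7\<close> and \<open>ad X\<^sub>8\<close>, so 11 relations are
  needed. The normalisation of \<open>D\<close> is \<open>D X\<^sub>1 = D X\<^sub>2 = 0\<close>.\<close>

lemma \<mu>2_weight_zero_cocycle:
  assumes \<omega>: "cocycle \<mu>2 \<omega>"
    and weight: "\<And>i j k. weight2 k \<noteq> weight2 i + weight2 j \<Longrightarrow> \<omega> (X i) (X j) $ k = 0"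
  shows "\<exists>D. linear D \<and> \<omega> = coboundary \<mu>2 D"
proof -
  have alt: "\<omega> \<in> alternating_maps" using \<omega> by (simp add: cocycle_def)
  define c where "c i j k = \<omega> (X i) (X j) $ k" for i j k
  have c: "\<omega> (X i) (X j) $ k = c i j k" for i j k
    by (simp add: c_def)
  have zero: "weight2 k \<noteq> weight2 i + weight2 j \<Longrightarrow> c i j k = 0" for i j k
    by (simp add: c_def weight)
  have skew: "c j i k = - c i j k" for i j k
    by (simp add: c_def alternating_skew[OF alt, of "X j"])
  have diag: "c i i k = 0" for i k
    by (simp add: c_def alternating_mapsD(2)[OF alt])
  note order = skew_8[of c, OF skew]
  note expand = sum_8 \<mu>2_nth X_nth c zero order diag weight2_values
  note J = cocycle_nth[OF \<omega>]
  have rel1: "- c 7 8 7 = 0"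
    using J[of 1 7 8 1] by (simp add: expand)
  have rel2: "2 * c 7 8 7 + c 7 8 8 = 0"
    using J[of 2 7 8 2] by (simp add: expand)
  have rel3: "c 1 7 1 + c 2 7 2 - c 3 7 3 = 0"
    using J[of 1 2 7 3] by (simp add: expand)
  have rel4: "c 1 8 1 + c 2 8 2 - c 3 8 3 = 0"
    using J[of 1 2 8 3] by (simp add: expand)
  have rel5: "c 1 7 1 + c 3 7 3 - c 4 7 4 = 0"
    using J[of 1 3 7 4] by (simp add: expand)
  have rel6: "c 1 8 1 + c 3 8 3 - c 4 8 4 = 0"
    using J[of 1 3 8 4] by (simp add: expand)
  have rel7: "c 1 7 1 + c 5 7 5 - c 6 7 6 = 0"
    using J[of 1 5 7 6] by (simp add: expand)
  have rel8: "c 1 8 1 + c 5 8 5 - c 6 8 6 = 0"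
    using J[of 1 5 8 6] by (simp add: expand)
  have rel9: "c 2 7 2 + c 3 7 3 - c 5 7 5 = 0"
    using J[of 2 3 7 5] by (simp add: expand)
  have rel10: "c 2 8 2 + c 3 8 3 - c 5 8 5 = 0"
    using J[of 2 3 8 5] by (simp add: expand)
  have rel11: "c 1 3 4 - c 1 5 6 - c 2 3 5 + c 2 4 6 = 0"
    using J[of 1 2 3 6] by (simp add: expand)
  note relations = rel1 rel2 rel3 rel4 rel5 rel6 rel7 rel8 rel9 rel10 rel11
  define d33 where "d33 = - c 1 2 3"
  define d44 where "d44 = - c 1 2 3 - c 1 3 4"
  define d55 where "d55 = - c 1 2 3 - c 2 3 5"
  define d66 where "d66 = - c 1 2 3 - c 1 5 6 - c 2 3 5"
  define d77 where "d77 = - c 1 7 1"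
  define d78 where "d78 = 2 * c 1 7 1 - c 2 7 2"
  define d87 where "d87 = - c 1 8 1"
  define d88 where "d88 = 2 * c 1 8 1 - c 2 8 2"
  define D :: "real^8 \<Rightarrow> real^8" where "D v =
      (v $ 3 * d33) *\<^sub>R X 3
      + (v $ 4 * d44) *\<^sub>R X 4
      + (v $ 5 * d55) *\<^sub>R X 5
      + (v $ 6 * d66) *\<^sub>R X 6
      + (v $ 7 * d77) *\<^sub>R X 7
      + (v $ 7 * d78) *\<^sub>R X 8
      + (v $ 8 * d87) *\<^sub>R X 7
      + (v $ 8 * d88) *\<^sub>R X 8" for v
  have D: "linear D"
    by (simp add: linear_iff D_def algebra_simps)
  have D_nth:
    "D v $ 1 = 0"
    "D v $ 2 = 0"
    "D v $ 3 = d33 * v $ 3"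
    "D v $ 4 = d44 * v $ 4"
    "D v $ 5 = d55 * v $ 5"
    "D v $ 6 = d66 * v $ 6"
    "D v $ 7 = d77 * v $ 7 + d87 * v $ 8"
    "D v $ 8 = d78 * v $ 7 + d88 * v $ 8"
    for v by (simp_all add: D_def X_nth)
  have coboundary_nth: "coboundary \<mu>2 D a b $ k = \<mu>2 (D a) b $ k + \<mu>2 a (D b) $ k - D (\<mu>2 a b) $ k"
    for a b k by (simp add: coboundary_def)
  have "\<forall>i j k. \<omega> (X i) (X j) $ k = coboundary \<mu>2 D (X i) (X j) $ k"
    using relations by (simp add: forall_8 coboundary_nth D_nth expand d33_def d44_def d55_def
      d66_def d77_def d78_def d87_def d88_def)
  then have "\<omega> = coboundary \<mu>2 D"
    using alternating_mapsD(1)[OF alt] alternating_mapsD(1)[OF coboundary_alternating[OF mu2.alt D]]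
    by (intro bilinear_eq_axis) (simp_all add: X_def vec_eq_iff)
  then show ?thesis using D by blast
qed

text \<open>On the nilradical a derivation of weight zero is diagonal and determined by its eigenvalues
  \<open>d\<^sub>1\<^sub>1\<close> and \<open>d\<^sub>2\<^sub>2\<close> at the generators \<open>X\<^sub>1\<close> and \<open>X\<^sub>2\<close>, where \<open>ad (a X\<^sub>7 + b X\<^sub>8)\<close> has the
  eigenvalues \<open>a\<close> and \<open>2 a + b\<close>.\<close>

lemma \<mu>2_weight_zero_derivation:
  assumes D: "derivation \<mu>2 D"
    and weight: "\<And>j k. weight2 k \<noteq> weight2 j \<Longrightarrow> D (X j) $ k = 0"
  shows "\<exists>z. D = \<mu>2 z"
proof -
  define d where "d j k = D (X j) $ k" for j k
  have d: "D (X j) $ k = d j k" for j k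
    by (simp add: d_def)
  have zero: "weight2 k \<noteq> weight2 j \<Longrightarrow> d j k = 0" for j k
    by (simp add: d_def weight)
  note expand = sum_8 \<mu>2_nth X_nth d zero weight2_values
  note L = derivation_nth[OF D]
  have rel1: "- d 7 7 = 0"
    using L[of 1 7 1] by (simp add: expand)
  have rel2: "- d 8 7 = 0"
    using L[of 1 8 1] by (simp add: expand)
  have rel3: "2 * d 7 7 + d 7 8 = 0"
    using L[of 2 7 2] by (simp add: expand)
  have rel4: "2 * d 8 7 + d 8 8 = 0"
    using L[of 2 8 2] by (simp add: expand)
  have rel5: "d 1 1 + d 2 2 - d 3 3 = 0"
    using L[of 1 2 3] by (simp add: expand)
  have rel6: "d 1 1 + d 3 3 - d 4 4 = 0"
    using L[of 1 3 4] by (simp add: expand)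
  have rel7: "d 1 1 + d 5 5 - d 6 6 = 0"
    using L[of 1 5 6] by (simp add: expand)
  have rel8: "d 2 2 + d 3 3 - d 5 5 = 0"
    using L[of 2 3 5] by (simp add: expand)
  note relations = rel1 rel2 rel3 rel4 rel5 rel6 rel7 rel8
  define z where "z = D (X 1) $ 1 *\<^sub>R X 7 + (D (X 2) $ 2 - 2 * D (X 1) $ 1) *\<^sub>R X 8"
  have "\<forall>j k. D (X j) $ k = \<mu>2 z (X j) $ k"
    using relations by (simp add: forall_8 z_def expand)
  then have "D = \<mu>2 z"
    using D lie_lawsD(1)[OF \<mu>2_lie_law]
    by (intro linear_eq_stdbasis)
      (auto dest!: basis_axis simp: X_def vec_eq_iff derivation_def bilinear_def)
  then show ?thesis by blast
qed

lemma center_\<mu>2: "center \<mu>2 = {0}"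
proof -
  have "z = 0" if z: "\<And>x. \<mu>2 z x = 0" for z
  proof -
    have "\<mu>2 z (X i) $ k = 0" for i k
      by (simp add: z)
    from this[of 7 1] this[of 7 2] this[of 7 3] this[of 7 4] this[of 7 5] this[of 7 6] this[of 1
      1] this[of 2 2]
    show ?thesis
      by (simp add: \<mu>2_nth X_nth vec_eq_iff forall_8)
  qed
  then show ?thesis
    using bilinear_lzero[OF lie_lawsD(1)[OF \<mu>2_lie_law]] by (auto simp: center_def)
qed

section \<open>Solvability and the imaginary eigenvalue\<close>

lemma derived_series_Suc_subset:
  assumes "derived_series \<mu> k \<subseteq> S" "subspace T" "\<And>x y. x \<in> S \<Longrightarrow> y \<in> S \<Longrightarrow> \<mu> x y \<in> T"
  shows "derived_series \<mu> (Suc k) \<subseteq> T"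
proof -
  have "{\<mu> x y | x y. x \<in> derived_series \<mu> k \<and> y \<in> derived_series \<mu> k} \<subseteq> T"
    using assms(1,3) by blast
  then show ?thesis
    using span_minimal assms(2) by (simp only: derived_series.simps)
qed

lemma solvable_\<mu>1: "solvable_algebra \<mu>1"
proof -
  let ?S1 = "{v :: real^8. v $ 7 = 0 \<and> v $ 8 = 0}"
  let ?S2 = "{v :: real^8. v $ 1 = 0 \<and> v $ 2 = 0 \<and> v $ 7 = 0 \<and> v $ 8 = 0}"
  have "derived_series \<mu>1 (Suc 0) \<subseteq> ?S1"
    by (rule derived_series_Suc_subset[where S = UNIV]) (auto simp: \<mu>1_nth subspace_def)
  then have "derived_series \<mu>1 (Suc (Suc 0)) \<subseteq> ?S2"
    by (rule derived_series_Suc_subset) (auto simp: \<mu>1_nth subspace_def)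
  then have "derived_series \<mu>1 (Suc (Suc (Suc 0))) \<subseteq> {0}"
    by (rule derived_series_Suc_subset) (auto simp: \<mu>1_nth vec_eq_iff forall_8 subspace_def)
  moreover have "0 \<in> derived_series \<mu>1 (Suc (Suc (Suc 0)))"
    by (simp add: span_zero)
  ultimately show ?thesis
    unfolding solvable_algebra_def by blast
qed

lemma solvable_\<mu>2: "solvable_algebra \<mu>2"
proof -
  let ?S1 = "{v :: real^8. v $ 7 = 0 \<and> v $ 8 = 0}"
  let ?S2 = "{v :: real^8. v $ 1 = 0 \<and> v $ 2 = 0 \<and> v $ 7 = 0 \<and> v $ 8 = 0}"
  have "derived_series \<mu>2 (Suc 0) \<subseteq> ?S1"
    by (rule derived_series_Suc_subset[where S = UNIV]) (auto simp: \<mu>2_nth subspace_def)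
  then have "derived_series \<mu>2 (Suc (Suc 0)) \<subseteq> ?S2"
    by (rule derived_series_Suc_subset) (auto simp: \<mu>2_nth subspace_def)
  then have "derived_series \<mu>2 (Suc (Suc (Suc 0))) \<subseteq> {0}"
    by (rule derived_series_Suc_subset) (auto simp: \<mu>2_nth vec_eq_iff forall_8 subspace_def)
  moreover have "0 \<in> derived_series \<mu>2 (Suc (Suc (Suc 0)))"
    by (simp add: span_zero)
  ultimately show ?thesis
    unfolding solvable_algebra_def by blast
qed

lemma \<mu>1_not_completely_solvable: "\<not> completely_solvable \<mu>1"
proof -
  define v :: "complex^8" where "v = (\<chi> k. if k = 1 then 1 else if k = 2 then - \<i> else 0)"
  have "map_matrix complex_of_real (matrix (\<mu>1 (X 8))) *v v = \<i> *s v"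
    by (simp add: vec_eq_iff forall_8 matrix_vector_mult_def sum_8 map_matrix_def matrix_def
        v_def \<mu>1_nth X_nth axis_def)
  moreover have "v $ 1 = 1" by (simp add: v_def)
  then have "v \<noteq> 0" by auto
  ultimately have "complex_eigenvalue (\<mu>1 (X 8)) \<i>"
    unfolding complex_eigenvalue_def by blast
  moreover have "\<i> \<notin> \<real>" by (simp add: complex_is_Real_iff)
  ultimately show ?thesis unfolding completely_solvable_def by blast
qed

section \<open>Rigidity and completeness\<close>

lemma rigid_\<mu>1: "rigid \<mu>1"
  by (rule mu1.rigid_by_weights) (simp add: \<mu>1_weight_zero_cocycle X_def)

lemma rigid_\<mu>2: "rigid \<mu>2"
  by (rule mu2.rigid_by_weights) (simp add: \<mu>2_weight_zero_cocycle X_def)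

lemma complete_\<mu>1: "complete_algebra \<mu>1"
  by (rule mu1.complete_by_weights[OF _ center_\<mu>1]) (simp add: \<mu>1_weight_zero_derivation X_def)

lemma complete_\<mu>2: "complete_algebra \<mu>2"
  by (rule mu2.complete_by_weights[OF _ center_\<mu>2]) (simp add: \<mu>2_weight_zero_derivation X_def)

theorem mainTheorem1:
  shows "\<mu>1 \<in> lie_laws \<and> solvable_algebra \<mu>1 \<and> \<mu>2 \<in> lie_laws \<and> solvable_algebra \<mu>2
    \<and> rigid \<mu>1 \<and> complete_algebra \<mu>1 \<and> rigid \<mu>2 \<and> complete_algebra \<mu>2
    \<and> \<not> completely_solvable \<mu>1"
  using \<mu>1_lie_law solvable_\<mu>1 \<mu>2_lie_law solvable_\<mu>2 rigid_\<mu>1 complete_\<mu>1 rigid_\<mu>2 complete_\<mu>2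
    \<mu>1_not_completely_solvable by blast

end
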